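(* Let $k$ be a nonnegative integer. The Lie algebra $\mathfrak e(4k+2,1)$ of the Poincaré group $P^{4k+3}$ admits a complex structure such that the embedding $\mathfrak e(4k+2)\oplus\mathbb R e_{4k+3}\hookrightarrow\mathfrak e(4k+2,1)$ is holomorphic, where $\mathfrak e(4k+2)\oplus\mathbb R e_{4k+3}$ carries the complex structure $J^0$ described in the context.
   Context: A complex structure on a real Lie algebra $\mathfrak g$ is an endomorphism $J$ with $J^2=-1$ and $J[x,y]-[Jx,y]-[x,Jy]-J[Jx,Jy]=0$ for all $x,y\in\mathfrak g$. A Lie algebra embedding is holomorphic if it intertwines the complex structures. $\mathfrak e(n)=\mathfrak{so}(n)\oplus_\rho\mathbb R^n$ and $\mathfrak e(n,1)=\mathfrak{so}(n,1)\oplus_\rho\mathbb R^{n,1}$, with $\rho$ the standard representations on column vectors and bracket $[(x,u),(y,v)]=([x,y],xv-yu)$; here $\mathfrak{so}(n,1)$ is the Lie algebra of the isometry group of the form $\mathrm{diag}(1,\dots,1,-1)$ on $\mathbb R^{n+1}$ and $e_1,\dots,e_{n+1}$ is the standard basis. $\mathfrak e(4k+2)\oplus\mathbb R e_{4k+3}$ is the Lie algebra direct sum with one-dimensional centre factor $\mathbb R e_{4k+3}$; it embeds in $\mathfrak e(4k+2,1)$ via the upper-left block $\mathfrak{so}(4k+2)\subset\mathfrak{so}(4k+2,1)$, $\mathbb R^{4k+2}=\mathrm{span}\{e_1,\dots,e_{4k+2}\}\subset\mathbb R^{4k+2,1}$, and $e_{4k+3}\mapsto e_{4k+3}\in\mathbb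 R^{4k+2,1}$. Let $e_{ij}$ be the elementary matrices, $f_{ij}=e_{ij}-e_{ji}$, $h_i=f_{2i-1,2i}$. The complex structure $J^0$ on $\mathfrak e(4k+2)\oplus\mathbb R e_{4k+3}$ is determined by $(J^0)^2=-1$ and $J^0h_{2i-1}=h_{2i}$ for $1\le i\le k$; $J^0h_{2k+1}=e_{4k+3}$; $J^0f_{2j-1,l}=f_{2j,l}$ for $2\le 2j<l\le 4k+2$; $J^0e_{2i-1}=e_{2i}$ for $1\le i\le 2k+1$. *)

theory Defs
  imports "Jordan_Normal_Form.VS_Connect"
begin

section \<open>Real Lie algebras\<close>

text \<open>The ring fields \<open>mult\<close> and \<open>one\<close> of the module record are unused, as in \<^const>\<open>module_vec\<close>.\<close>

record 'a real_lie = "(real, 'a) module" +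
  bracket :: "'a \<Rightarrow> 'a \<Rightarrow> 'a"

locale real_lie_algebra = vectorspace "class_ring :: real ring" L
  for L :: "('a, 'b) real_lie_scheme" (structure) +
  assumes bracket_closed: "\<lbrakk>x \<in> carrier L; y \<in> carrier L\<rbrakk> \<Longrightarrow> bracket L x y \<in> carrier L"
    and bracket_add_left: "\<lbrakk>x \<in> carrier L; y \<in> carrier L; z \<in> carrier L\<rbrakk> \<Longrightarrow>
      bracket L (x \<oplus> y) z = bracket L x z \<oplus> bracket L y z"
    and bracket_add_right: "\<lbrakk>x \<in> carrier L; y \<in> carrier L; z \<in> carrier L\<rbrakk> \<Longrightarrow>
      bracket L x (y \<oplus> z) = bracket L x y \<oplus> bracket L x z"
    and bracket_smult_left: "\<lbrakk>x \<in> carrier L; y \<in> carrier L\<rbrakk> \<Longrightarrow>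
      bracket L (c \<odot> x) y = c \<odot> bracket L x y"
    and bracket_smult_right: "\<lbrakk>x \<in> carrier L; y \<in> carrier L\<rbrakk> \<Longrightarrow>
      bracket L x (c \<odot> y) = c \<odot> bracket L x y"
    and bracket_self: "x \<in> carrier L \<Longrightarrow> bracket L x x = \<zero>"
    and jacobi: "\<lbrakk>x \<in> carrier L; y \<in> carrier L; z \<in> carrier L\<rbrakk> \<Longrightarrow>
      bracket L x (bracket L y z) \<oplus> bracket L y (bracket L z x)
        \<oplus> bracket L z (bracket L x y) = \<zero>"

definition complex_structure :: "('a, 'b) real_lie_scheme \<Rightarrow> ('a \<Rightarrow> 'a) \<Rightarrow> bool" where
  "complex_structure L J \<longleftrightarrow> real_lie_algebra L \<and>
    J \<in> LinearCombinations.module_hom class_ring L L \<and>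
    (\<forall>x \<in> carrier L. J (J x) = \<ominus>\<^bsub>L\<^esub> x) \<and>
    (\<forall>x \<in> carrier L. \<forall>y \<in> carrier L.
      J (bracket L x y) \<ominus>\<^bsub>L\<^esub> bracket L (J x) y \<ominus>\<^bsub>L\<^esub> bracket L x (J y)
        \<ominus>\<^bsub>L\<^esub> J (bracket L (J x) (J y)) = \<zero>\<^bsub>L\<^esub>)"

definition lie_embedding ::
    "('a, 'c) real_lie_scheme \<Rightarrow> ('b, 'd) real_lie_scheme \<Rightarrow> ('a \<Rightarrow> 'b) \<Rightarrow> bool" where
  "lie_embedding L M \<phi> \<longleftrightarrow> real_lie_algebra L \<and> real_lie_algebra M \<and>
    \<phi> \<in> LinearCombinations.module_hom class_ring L M \<and> inj_on \<phi> (carrier L) \<and>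
    (\<forall>x \<in> carrier L. \<forall>y \<in> carrier L. \<phi> (bracket L x y) = bracket M (\<phi> x) (\<phi> y))"

definition holomorphic_embedding ::
    "('a, 'c) real_lie_scheme \<Rightarrow> ('a \<Rightarrow> 'a) \<Rightarrow> ('b, 'd) real_lie_scheme \<Rightarrow> ('b \<Rightarrow> 'b) \<Rightarrow>
      ('a \<Rightarrow> 'b) \<Rightarrow> bool" where
  "holomorphic_embedding L J M J' \<phi> \<longleftrightarrow>
    complex_structure L J \<and> complex_structure M J' \<and> lie_embedding L M \<phi> \<and>
    (\<forall>x \<in> carrier L. \<phi> (J x) = J' (\<phi> x))"

definition lie_direct_sum :: "'a real_lie \<Rightarrow> 'b real_lie \<Rightarrow> ('a \<times> 'b) real_lie" where
  "lie_direct_sum L M = \<lparr>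
    carrier = carrier L \<times> carrier M,
    mult = undefined,
    one = undefined,
    zero = (\<zero>\<^bsub>L\<^esub>, \<zero>\<^bsub>M\<^esub>),
    add = (\<lambda>(x, y) (x', y'). (x \<oplus>\<^bsub>L\<^esub> x', y \<oplus>\<^bsub>M\<^esub> y')),
    smult = (\<lambda>c (x, y). (c \<odot>\<^bsub>L\<^esub> x, c \<odot>\<^bsub>M\<^esub> y)),
    bracket = (\<lambda>(x, y) (x', y'). (bracket L x x', bracket M y y'))\<rparr>"

definition line_lie :: "real real_lie" where
  "line_lie = \<lparr>
    carrier = UNIV,
    mult = undefined,
    one = undefined,
    zero = 0,
    add = (+),
    smult = (*),
    bracket = (\<lambda>_ _. 0)\<rparr>"

lemma class_ring_simps_real [simp]:
  "carrier (class_ring :: real ring) = UNIV" "add (class_ring :: real ring) = (+)"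
  "mult (class_ring :: real ring) = (*)" "one (class_ring :: real ring) = 1"
  by auto

lemma real_lie_vectorspaceI:
  assumes "module (class_ring :: real ring) L"
  shows "vectorspace (class_ring :: real ring) L"
  using assms class_field by (auto simp: vectorspace_def)

lemma line_lie_algebra: "real_lie_algebra line_lie"
proof -
  have "module (class_ring :: real ring) line_lie"
    by (rule module_criteria[OF class_cring.cring_axioms])
      (auto simp: line_lie_def algebra_simps intro: exI[of _ "- x" for x])
  then show ?thesis
    unfolding real_lie_algebra_def
    by (auto intro!: real_lie_vectorspaceI simp: real_lie_algebra_axioms_def line_lie_def)
qed

lemma lie_direct_sum_algebra:
  assumes "real_lie_algebra L" "real_lie_algebra M"
  shows "real_lie_algebra (lie_direct_sum L M)"
proof -
  interpret L: real_lie_algebra L by fact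
  interpret M: real_lie_algebra M by fact
  have "module (class_ring :: real ring) (lie_direct_sum L M)"
  proof (rule module_criteria[OF class_cring.cring_axioms], goal_cases)
    case 3
    show ?case
    proof
      fix v assume "v \<in> carrier (lie_direct_sum L M)"
      then show "\<exists>w \<in> carrier (lie_direct_sum L M).
          v \<oplus>\<^bsub>lie_direct_sum L M\<^esub> w = \<zero>\<^bsub>lie_direct_sum L M\<^esub>"
        by (intro bexI[of _ "(\<ominus>\<^bsub>L\<^esub> fst v, \<ominus>\<^bsub>M\<^esub> snd v)"])
          (auto simp: lie_direct_sum_def L.r_neg M.r_neg)
    qed
  qed (auto simp: lie_direct_sum_def L.a_ac M.a_ac L.smult_assoc1[simplified]
      M.smult_assoc1[simplified] L.smult_l_distr[simplified] M.smult_l_distr[simplified] L.smult_r_distr M.smult_r_distr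
      L.smult_one[simplified] M.smult_one[simplified])
  then show ?thesis
    unfolding real_lie_algebra_def
    by (auto intro!: real_lie_vectorspaceI simp: real_lie_algebra_axioms_def lie_direct_sum_def
        L.bracket_closed M.bracket_closed L.bracket_add_left M.bracket_add_left
        L.bracket_add_right M.bracket_add_right L.bracket_smult_left M.bracket_smult_left
        L.bracket_smult_right M.bracket_smult_right L.bracket_self M.bracket_self
        L.jacobi M.jacobi)
qed

section \<open>Inhomogeneous isometry algebras\<close>

text \<open>The Lie algebra of the isometry group of the bilinear form with Gram matrix \<open>Q\<close> on column
  vectors of length \<open>m\<close>.\<close>

definition so_form :: "nat \<Rightarrow> real mat \<Rightarrow> real mat set" where
  "so_form m Q = {A \<in> carrier_mat m m. transpose_mat A * Q + Q * A = 0\<^sub>m m m}"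

lemma so_form_iff:
  assumes Q: "Q \<in> carrier_mat m m" and A: "A \<in> carrier_mat m m"
  shows "A \<in> so_form m Q \<longleftrightarrow> transpose_mat A * Q = - (Q * A)"
proof -
  have dims: "transpose_mat A * Q \<in> carrier_mat m m" "Q * A \<in> carrier_mat m m"
    using Q A by auto
  have eq0: "X + Y = 0\<^sub>m m m \<longleftrightarrow> X = - Y"
    if "X \<in> carrier_mat m m" "Y \<in> carrier_mat m m" for X Y :: "real mat"
    using that by (auto simp: mat_eq_iff eq_neg_iff_add_eq_0)
  show ?thesis
    using A eq0[OF dims] by (simp add: so_form_def)
qed

lemma so_form_one_iff:
  assumes "A \<in> carrier_mat n n"
  shows "A \<in> so_form n (1\<^sub>m n) \<longleftrightarrow> transpose_mat A = - A"
  using assms by (simp add: so_form_iff)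

lemma so_form_carrier: "A \<in> so_form m Q \<Longrightarrow> A \<in> carrier_mat m m"
  by (simp add: so_form_def)

lemma so_form_zero: "Q \<in> carrier_mat m m \<Longrightarrow> 0\<^sub>m m m \<in> so_form m Q"
  by (simp add: so_form_def)

lemma so_form_add:
  assumes Q: "Q \<in> carrier_mat m m" and A: "A \<in> so_form m Q" and B: "B \<in> so_form m Q"
  shows "A + B \<in> so_form m Q"
proof -
  note c = so_form_carrier[OF A] so_form_carrier[OF B]
  have ac: "transpose_mat A \<in> carrier_mat m m" "transpose_mat B \<in> carrier_mat m m" using c by auto
  have "transpose_mat (A + B) * Q = transpose_mat A * Q + transpose_mat B * Q"
    using c ac Q by (simp add: transpose_add add_mult_distrib_mat)
  also have "\<dots> = - (Q * A) + - (Q * B)"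
    using A B c Q by (simp add: so_form_iff)
  also have "\<dots> = - (Q * (A + B))"
    using c Q by (simp add: mult_add_distrib_mat uminus_add_minus_mat[of _ m m]) 
      (auto simp: mat_eq_iff)
  finally show ?thesis using c Q by (simp add: so_form_iff)
qed

lemma so_form_smult:
  assumes Q: "Q \<in> carrier_mat m m" and A: "A \<in> so_form m Q"
  shows "c \<cdot>\<^sub>m A \<in> so_form m Q"
proof -
  note c = so_form_carrier[OF A]
  have t: "transpose_mat A \<in> carrier_mat m m" using c by auto
  have "transpose_mat (c \<cdot>\<^sub>m A) = c \<cdot>\<^sub>m transpose_mat A"
    using c by (auto simp: mat_eq_iff)
  then have "transpose_mat (c \<cdot>\<^sub>m A) * Q = c \<cdot>\<^sub>m (transpose_mat A * Q)"
    using mult_smult_assoc_mat[OF t Q] by simp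
  also have "\<dots> = - (Q * (c \<cdot>\<^sub>m A))"
    using A c Q mult_smult_distrib[OF Q c] by (auto simp: so_form_iff mat_eq_iff)
  finally show ?thesis using c Q by (simp add: so_form_iff)
qed

lemma so_form_bracket:
  assumes Q: "Q \<in> carrier_mat m m" and A: "A \<in> so_form m Q" and B: "B \<in> so_form m Q"
  shows "A * B - B * A \<in> so_form m Q"
proof -
  note c = so_form_carrier[OF A] so_form_carrier[OF B]
  have t: "transpose_mat A \<in> carrier_mat m m" "transpose_mat B \<in> carrier_mat m m" using c by auto
  have key: "transpose_mat (X * Y) * Q = Q * (Y * X)"
    if X: "X \<in> so_form m Q" and Y: "Y \<in> so_form m Q" for X Y
  proof -
    note d = so_form_carrier[OF X] so_form_carrier[OF Y]
    have dt: "transpose_mat X \<in> carrier_mat m m" "transpose_mat Y \<in> carrier_mat m m"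
      using d by auto
    have "transpose_mat (X * Y) * Q = transpose_mat Y * (transpose_mat X * Q)"
      using d dt Q by (simp add: transpose_mult assoc_mult_mat[of _ m m _ m _ m])
    also have "\<dots> = - (transpose_mat Y * (Q * X))"
      using X Q d dt by (simp add: so_form_iff)
    also have "\<dots> = - ((transpose_mat Y * Q) * X)"
      using Q d dt by (simp add: assoc_mult_mat[of _ m m _ m _ m])
    also have "\<dots> = (Q * Y) * X"
      using Y Q d dt by (simp add: so_form_iff)
    also have "\<dots> = Q * (Y * X)"
      using Q d dt by (simp add: assoc_mult_mat[of _ m m _ m _ m])
    finally show ?thesis .
  qed
  have tm: "transpose_mat (A * B) \<in> carrier_mat m m" "transpose_mat (B * A) \<in> carrier_mat m m"
    using c by auto
  have "transpose_mat (A * B - B * A) = transpose_mat (A * B) - transpose_mat (B * A)"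
    using c by (auto simp: mat_eq_iff)
  then have "transpose_mat (A * B - B * A) * Q = Q * (B * A) - Q * (A * B)"
    using key[OF A B] key[OF B A] tm Q by (simp add: minus_mult_distrib_mat)
  also have "\<dots> = - (Q * (A * B - B * A))"
    using c Q mult_minus_distrib_mat[of Q m m "A * B" m "B * A"] by (auto simp: mat_eq_iff)
  finally have "transpose_mat (A * B - B * A) * Q = - (Q * (A * B - B * A))" .
  moreover have "A * B - B * A \<in> carrier_mat m m"
    using c by (intro minus_carrier_mat) auto
  ultimately show ?thesis using so_form_iff[OF Q] by blast
qed

definition affine_lie :: "nat \<Rightarrow> real mat \<Rightarrow> (real mat \<times> real vec) real_lie" where
  "affine_lie m Q = \<lparr>
    carrier = so_form m Q \<times> carrier_vec m,
    mult = undefined,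
    one = undefined,
    zero = (0\<^sub>m m m, 0\<^sub>v m),
    add = (\<lambda>(x, u) (y, v). (x + y, u + v)),
    smult = (\<lambda>c (x, u). (c \<cdot>\<^sub>m x, c \<cdot>\<^sub>v u)),
    bracket = (\<lambda>(x, u) (y, v). (x * y - y * x, x *\<^sub>v v - y *\<^sub>v u))\<rparr>"

lemma commutator_jacobi:
  fixes x y z :: "real mat"
  assumes c: "x \<in> carrier_mat m m" "y \<in> carrier_mat m m" "z \<in> carrier_mat m m"
  shows "(x * (y * z - z * y) - (y * z - z * y) * x) + (y * (z * x - x * z) - (z * x - x * z) * y)
    + (z * (x * y - y * x) - (x * y - y * x) * z) = 0\<^sub>m m m"
proof -
  have e: "a * (b * d - d * b) - (b * d - d * b) * a
      = a * (b * d) - a * (d * b) - (b * (d * a) - d * (b * a))"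
    if "a \<in> carrier_mat m m" "b \<in> carrier_mat m m" "d \<in> carrier_mat m m" for a b d :: "real mat"
  proof -
    have p: "b * d \<in> carrier_mat m m" "d * b \<in> carrier_mat m m"
      using that by auto
    show ?thesis
      using mult_minus_distrib_mat[OF that(1) p] minus_mult_distrib_mat[OF p that(1)] that
      by (simp add: assoc_mult_mat[of _ m m _ m _ m])
  qed
  have cyc: "(X - Y - (Z - W)) + (Z - U - (V - Y)) + (V - W - (X - U)) = 0\<^sub>m m m"
    if "X \<in> carrier_mat m m" "Y \<in> carrier_mat m m" "Z \<in> carrier_mat m m"
      "U \<in> carrier_mat m m" "V \<in> carrier_mat m m" "W \<in> carrier_mat m m"
    for X Y Z U V W :: "real mat"
    using that by (auto simp: mat_eq_iff)
  have t: "a * (b * d) \<in> carrier_mat m m"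
    if "a \<in> carrier_mat m m" "b \<in> carrier_mat m m" "d \<in> carrier_mat m m" for a b d :: "real mat"
    using that by auto
  show ?thesis
    unfolding e[OF c] e[OF c(2,3,1)] e[OF c(3,1,2)]
    by (rule cyc; intro t c)
qed

lemma affine_lie_algebra:
  assumes Q: "Q \<in> carrier_mat m m"
  shows "real_lie_algebra (affine_lie m Q)"
proof -
  have "module (class_ring :: real ring) (affine_lie m Q)"
  proof (rule module_criteria[OF class_cring.cring_axioms], goal_cases)
    case 3
    show ?case
    proof
      fix v assume "v \<in> carrier (affine_lie m Q)"
      then show "\<exists>w \<in> carrier (affine_lie m Q).
          v \<oplus>\<^bsub>affine_lie m Q\<^esub> w = \<zero>\<^bsub>affine_lie m Q\<^esub>"
        using so_form_smult[OF Q]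
        by (intro bexI[of _ "((- 1) \<cdot>\<^sub>m fst v, (- 1) \<cdot>\<^sub>v snd v)"])
          (auto simp: affine_lie_def mat_eq_iff vec_eq_iff dest: so_form_carrier)
    qed
  qed (use so_form_zero[OF Q] so_form_add[OF Q] so_form_smult[OF Q] in
      \<open>auto simp: affine_lie_def mat_eq_iff vec_eq_iff algebra_simps dest!: so_form_carrier\<close>)
  moreover have smv: "(c \<cdot>\<^sub>m A) *\<^sub>v v = c \<cdot>\<^sub>v (A *\<^sub>v v)"
    if "A \<in> carrier_mat m m" "v \<in> carrier_vec m" for c and A :: "real mat" and v
    using that by (auto simp: vec_eq_iff)
  moreover have "real_lie_algebra_axioms (affine_lie m Q)"
  proof (unfold_locales, goal_cases)
    case (1 x y)
    then show ?case
      using so_form_bracket[OF Q]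
      by (auto simp: affine_lie_def intro!: minus_carrier_vec mult_mat_vec_carrier
          dest: so_form_carrier)
  next
    case (2 x y z)
    then show ?case
      by (auto simp: affine_lie_def dest!: so_form_carrier)
        (auto simp: add_mult_distrib_mat[of _ m m] mult_add_distrib_mat[of _ m m]
          add_mult_distrib_mat_vec[of _ m m] mult_add_distrib_mat_vec[of _ m m]
          mat_eq_iff vec_eq_iff)
  next
    case (3 x y z)
    then show ?case
      by (auto simp: affine_lie_def dest!: so_form_carrier)
        (auto simp: add_mult_distrib_mat[of _ m m] mult_add_distrib_mat[of _ m m]
          add_mult_distrib_mat_vec[of _ m m] mult_add_distrib_mat_vec[of _ m m]
          mat_eq_iff vec_eq_iff)
  next
    case (4 x y c)
    then show ?case
      by (auto simp: affine_lie_def dest!: so_form_carrier)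
        (auto simp: mult_smult_distrib[of _ m m] mult_smult_assoc_mat[of _ m m]
          smv mult_mat_vec[of _ m m]
          mat_eq_iff vec_eq_iff algebra_simps)
  next
    case (5 x y c)
    then show ?case
      by (auto simp: affine_lie_def dest!: so_form_carrier)
        (auto simp: mult_smult_distrib[of _ m m] mult_smult_assoc_mat[of _ m m]
          smv mult_mat_vec[of _ m m]
          mat_eq_iff vec_eq_iff algebra_simps)
  next
    case (6 x)
    then show ?case
      by (auto simp: affine_lie_def mat_eq_iff vec_eq_iff dest!: so_form_carrier)
  next
    case (7 x y z)
    have vecs: "(a *\<^sub>v (b *\<^sub>v w - c *\<^sub>v v) - (b * c - c * b) *\<^sub>v u)
      + (b *\<^sub>v (c *\<^sub>v u - a *\<^sub>v w) - (c * a - a * c) *\<^sub>v v)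
      + (c *\<^sub>v (a *\<^sub>v v - b *\<^sub>v u) - (a * b - b * a) *\<^sub>v w) = 0\<^sub>v m"
      if "a \<in> carrier_mat m m" "b \<in> carrier_mat m m" "c \<in> carrier_mat m m"
        "u \<in> carrier_vec m" "v \<in> carrier_vec m" "w \<in> carrier_vec m"
      for a b c :: "real mat" and u v w :: "real vec"
      using that
      by (simp add: mult_minus_distrib_mat_vec[of _ m m] minus_mult_distrib_mat_vec[of _ m m]
          assoc_mult_mat_vec[of _ m m _ m])
        (auto simp: vec_eq_iff)
    from 7 show ?case
      using commutator_jacobi[of _ m] vecs
      by (auto simp: affine_lie_def dest!: so_form_carrier)
  qed
  ultimately show ?thesis
    unfolding real_lie_algebra_def by (auto intro!: real_lie_vectorspaceI)
qed

definition euclidean_lie :: "nat \<Rightarrow> (real mat \<times> real vec) real_lie" where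
  "euclidean_lie n = affine_lie n (1\<^sub>m n)"

definition poincare_lie :: "nat \<Rightarrow> (real mat \<times> real vec) real_lie" where
  "poincare_lie n = affine_lie (Suc n) (mat_diag (Suc n) (\<lambda>i. if i < n then 1 else - 1))"

definition euclidean_line_lie :: "nat \<Rightarrow> ((real mat \<times> real vec) \<times> real) real_lie" where
  "euclidean_line_lie n = lie_direct_sum (euclidean_lie n) line_lie"

lemma euclidean_lie_algebra: "real_lie_algebra (euclidean_lie n)"
  unfolding euclidean_lie_def by (rule affine_lie_algebra) simp

lemma poincare_lie_algebra: "real_lie_algebra (poincare_lie n)"
  unfolding poincare_lie_def by (rule affine_lie_algebra) simp

lemma euclidean_line_lie_algebra: "real_lie_algebra (euclidean_line_lie n)"
  unfolding euclidean_line_lie_def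
  by (intro lie_direct_sum_algebra euclidean_lie_algebra line_lie_algebra)

definition block_embedding :: "nat \<Rightarrow> (real mat \<times> real vec) \<times> real \<Rightarrow> real mat \<times> real vec" where
  "block_embedding n = (\<lambda>((x, u), t).
    (four_block_mat x (0\<^sub>m n 1) (0\<^sub>m 1 n) (0\<^sub>m 1 1), u @\<^sub>v vec 1 (\<lambda>_. t)))"

section \<open>The complex structure on the Euclidean algebra with a line\<close>

text \<open>Row, column and basis-vector labels \<open>i\<close>, \<open>j\<close> of the elements below start at 1, whereas
  matrix and vector indices start at 0.\<close>

definition elem_mat :: "nat \<Rightarrow> nat \<Rightarrow> nat \<Rightarrow> real mat" where
  "elem_mat n i j = mat n n (\<lambda>(a, b). if Suc a = i \<and> Suc b = j then 1 else 0)"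

definition f_elt :: "nat \<Rightarrow> nat \<Rightarrow> nat \<Rightarrow> (real mat \<times> real vec) \<times> real" where
  "f_elt n i j = ((elem_mat n i j - elem_mat n j i, 0\<^sub>v n), 0)"

definition h_elt :: "nat \<Rightarrow> nat \<Rightarrow> (real mat \<times> real vec) \<times> real" where
  "h_elt n i = f_elt n (2 * i - 1) (2 * i)"

definition e_elt :: "nat \<Rightarrow> nat \<Rightarrow> (real mat \<times> real vec) \<times> real" where
  "e_elt n i = ((0\<^sub>m n n, unit_vec n (i - 1)), 0)"

definition central_elt :: "nat \<Rightarrow> (real mat \<times> real vec) \<times> real" where
  "central_elt n = ((0\<^sub>m n n, 0\<^sub>v n), 1)"

definition is_J0 ::
    "nat \<Rightarrow> ((real mat \<times> real vec) \<times> real \<Rightarrow> (real mat \<times> real vec) \<times> real) \<Rightarrow> bool" where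
  "is_J0 k J \<longleftrightarrow> (let n = 4 * k + 2; L = euclidean_line_lie n in
    J \<in> LinearCombinations.module_hom class_ring L L \<and>
    (\<forall>x \<in> carrier L. J (J x) = \<ominus>\<^bsub>L\<^esub> x) \<and>
    (\<forall>i. 1 \<le> i \<and> i \<le> k \<longrightarrow> J (h_elt n (2 * i - 1)) = h_elt n (2 * i)) \<and>
    J (h_elt n (2 * k + 1)) = central_elt n \<and>
    (\<forall>j l. 2 \<le> 2 * j \<and> 2 * j < l \<and> l \<le> n \<longrightarrow>
      J (f_elt n (2 * j - 1) l) = f_elt n (2 * j) l) \<and>
    (\<forall>i. 1 \<le> i \<and> i \<le> 2 * k + 1 \<longrightarrow> J (e_elt n (2 * i - 1)) = e_elt n (2 * i)))"

text \<open>Restricting to \<^const>\<open>extensional\<close> functions makes the determined map unique as a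
  function on the whole type.\<close>

definition J0 :: "nat \<Rightarrow> (real mat \<times> real vec) \<times> real \<Rightarrow> (real mat \<times> real vec) \<times> real" where
  "J0 k = (THE J. J \<in> extensional (carrier (euclidean_line_lie (4 * k + 2))) \<and> is_J0 k J)"

text \<open>The rest of the theory shows that exactly one such map exists (\<open>J0_ex1\<close>) and gives it in
  coordinates (\<open>J0_eq_coord\<close>).\<close>

lemma euclidean_line_simps:
  "carrier (euclidean_line_lie n) = (so_form n (1\<^sub>m n) \<times> carrier_vec n) \<times> UNIV"
  "zero (euclidean_line_lie n) = ((0\<^sub>m n n, 0\<^sub>v n), 0)"
  "add (euclidean_line_lie n) = (\<lambda>((x, u), s) ((y, v), t). ((x + y, u + v), s + t))"
  "smult (euclidean_line_lie n) = (\<lambda>c ((x, u), s). ((c \<cdot>\<^sub>m x, c \<cdot>\<^sub>v u), c * s))"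
  by (auto simp: euclidean_line_lie_def lie_direct_sum_def euclidean_lie_def affine_lie_def
      line_lie_def fun_eq_iff)

lemma euclidean_line_uminus:
  assumes "((x, u), t) \<in> carrier (euclidean_line_lie n)"
  shows "\<ominus>\<^bsub>euclidean_line_lie n\<^esub> ((x, u), t) = ((- x, - u), - t)"
proof -
  interpret L: real_lie_algebra "euclidean_line_lie n" by (rule euclidean_line_lie_algebra)
  have "- x \<in> so_form n (1\<^sub>m n)"
  proof -
    have c: "x \<in> so_form n (1\<^sub>m n)" "x \<in> carrier_mat n n"
      using assms so_form_carrier by (auto simp: euclidean_line_simps)
    have "- x = (- 1) \<cdot>\<^sub>m x" using c by (auto simp: mat_eq_iff)
    then show ?thesis using so_form_smult[OF _ c(1), of "- 1"] by simp
  qed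
  with assms show ?thesis
    by (intro L.minus_equality)
      (auto simp: euclidean_line_simps mat_eq_iff vec_eq_iff dest!: so_form_carrier)
qed

lemma e_elt_carrier: "e_elt n i \<in> carrier (euclidean_line_lie n)"
  by (auto simp: e_elt_def euclidean_line_simps so_form_zero)

lemma central_elt_carrier: "central_elt n \<in> carrier (euclidean_line_lie n)"
  by (auto simp: central_elt_def euclidean_line_simps so_form_zero)

lemma skew_entries:
  assumes "x \<in> so_form n (1\<^sub>m n)" "i < n" "j < n"
  shows "x $$ (j, i) = - x $$ (i, j)"
proof -
  have c: "x \<in> carrier_mat n n" using assms so_form_carrier by blast
  then have "transpose_mat x = - x" using assms so_form_one_iff by blast
  then have "transpose_mat x $$ (i, j) = (- x) $$ (i, j)" by simp
  then show ?thesis using c assms by simp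
qed

lemma so_form_oneI:
  assumes "x \<in> carrier_mat n n" "\<And>i j. i < n \<Longrightarrow> j < n \<Longrightarrow> x $$ (j, i) = - x $$ (i, j)"
  shows "x \<in> so_form n (1\<^sub>m n)"
proof -
  have "transpose_mat x = - x"
  proof (rule eq_matI)
    fix i j assume "i < dim_row (- x)" "j < dim_col (- x)"
    then show "transpose_mat x $$ (i, j) = (- x) $$ (i, j)"
      using assms(1) assms(2)[of i j] by simp
  qed (use assms(1) in auto)
  then show ?thesis using assms(1) so_form_one_iff by blast
qed

lemma elem_mat_carrier: "elem_mat n i j \<in> carrier_mat n n"
  by (simp add: elem_mat_def)

lemma elem_mat_entry:
  "\<lbrakk>a < n; b < n\<rbrakk> \<Longrightarrow> elem_mat n i j $$ (a, b) = (if Suc a = i \<and> Suc b = j then 1 else 0)"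
  by (simp add: elem_mat_def)

lemma elem_mat_diff_entry:
  "\<lbrakk>a < n; b < n\<rbrakk> \<Longrightarrow> (elem_mat n i j - elem_mat n j i) $$ (a, b) =
    (if Suc a = i \<and> Suc b = j then 1 else 0) - (if Suc a = j \<and> Suc b = i then 1 else 0)"
  using elem_mat_carrier[of n j i] by (simp add: elem_mat_entry)

lemma f_so: "elem_mat n i j - elem_mat n j i \<in> so_form n (1\<^sub>m n)"
proof (rule so_form_oneI)
  fix a b assume ab: "a < n" "b < n"
  show "(elem_mat n i j - elem_mat n j i) $$ (b, a) = - (elem_mat n i j - elem_mat n j i) $$ (a, b)"
    unfolding elem_mat_diff_entry[OF ab] elem_mat_diff_entry[OF ab(2,1)] minus_diff_eq
    by (simp only: conj_commute)
qed (intro minus_carrier_mat elem_mat_carrier)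

lemma f_elt_carrier: "f_elt n i j \<in> carrier (euclidean_line_lie n)"
  using f_so by (simp add: f_elt_def euclidean_line_simps)

lemma euclidean_line_induct:
  assumes x: "X \<in> carrier (euclidean_line_lie n)"
    and add: "\<And>Y Z. \<lbrakk>Y \<in> carrier (euclidean_line_lie n); Z \<in> carrier (euclidean_line_lie n); P Y; P Z\<rbrakk>
      \<Longrightarrow> P (Y \<oplus>\<^bsub>euclidean_line_lie n\<^esub> Z)"
    and smult: "\<And>c Y. \<lbrakk>Y \<in> carrier (euclidean_line_lie n); P Y\<rbrakk>
      \<Longrightarrow> P (c \<odot>\<^bsub>euclidean_line_lie n\<^esub> Y)"
    and f: "\<And>i j. \<lbrakk>1 \<le> i; i < j; j \<le> n\<rbrakk> \<Longrightarrow> P (f_elt n i j)"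
    and e: "\<And>i. \<lbrakk>1 \<le> i; i \<le> n\<rbrakk> \<Longrightarrow> P (e_elt n i)"
    and central: "P (central_elt n)"
  shows "P X"
proof -
  let ?L = "euclidean_line_lie n"
  obtain x u t where X: "X = ((x, u), t)" by (metis surj_pair)
  have xs: "x \<in> so_form n (1\<^sub>m n)" and u: "u \<in> carrier_vec n"
    using x by (auto simp: X euclidean_line_simps)
  have xc: "x \<in> carrier_mat n n" using xs so_form_carrier by blast
  have zero: "P ((0\<^sub>m n n, 0\<^sub>v n), 0)"
  proof -
    have "0 \<odot>\<^bsub>?L\<^esub> central_elt n = ((0\<^sub>m n n, 0\<^sub>v n), 0)"
      by (auto simp: central_elt_def euclidean_line_simps mat_eq_iff vec_eq_iff)
    then show ?thesis using smult[OF central_elt_carrier central, of 0] by simp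
  qed
  have z: "P ((0\<^sub>m n n, 0\<^sub>v n), t)"
  proof -
    have "t \<odot>\<^bsub>?L\<^esub> central_elt n = ((0\<^sub>m n n, 0\<^sub>v n), t)"
      by (auto simp: central_elt_def euclidean_line_simps mat_eq_iff vec_eq_iff)
    then show ?thesis using smult[OF central_elt_carrier central, of t] by simp
  qed
  have "P ((0\<^sub>m n n, vec n (\<lambda>i. if i < m then u $ i else 0)), 0)" if "m \<le> n" for m
    using that
  proof (induction m)
    case 0
    have "vec n (\<lambda>i. 0) = (0\<^sub>v n :: real vec)" by auto
    then show ?case using zero by simp
  next
    case (Suc m)
    let ?Y = "((0\<^sub>m n n, vec n (\<lambda>i. if i < m then u $ i else 0)), 0 :: real)"
    let ?Z = "u $ m \<odot>\<^bsub>?L\<^esub> e_elt n (Suc m)"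
    have "P ?Z" using Suc.prems by (intro smult e e_elt_carrier) auto
    moreover have "?Z \<in> carrier ?L" "?Y \<in> carrier ?L"
      by (auto simp: e_elt_def euclidean_line_simps so_form_zero so_form_smult)
    ultimately have "P (?Y \<oplus>\<^bsub>?L\<^esub> ?Z)" using Suc by (intro add) auto
    moreover have "?Y \<oplus>\<^bsub>?L\<^esub> ?Z = ((0\<^sub>m n n, vec n (\<lambda>i. if i < Suc m then u $ i else 0)), 0)"
      using Suc.prems
      by (auto simp: e_elt_def euclidean_line_simps mat_eq_iff vec_eq_iff less_Suc_eq)
    ultimately show ?case by simp
  qed
  from this[of n] have v: "P ((0\<^sub>m n n, u), 0)"
  proof -
    have "vec n (\<lambda>i. if i < n then u $ i else 0) = u" using u by auto
    then show ?thesis using \<open>n \<le> n \<Longrightarrow> _\<close> by simp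
  qed
  define R where "R S = mat n n (\<lambda>(a, b). if (a, b) \<in> S \<or> (b, a) \<in> S then x $$ (a, b) else 0)"
    for S
  have R: "R S \<in> so_form n (1\<^sub>m n)" for S
  proof (rule so_form_oneI)
    fix a b assume "a < n" "b < n"
    then show "R S $$ (b, a) = - R S $$ (a, b)"
      using skew_entries[OF xs, of a b] by (auto simp: R_def)
  qed (simp add: R_def)
  have "P ((R S, 0\<^sub>v n), 0)" if "finite S" "S \<subseteq> {(i, j). i < j \<and> j < n}" for S
    using that
  proof (induction S rule: finite_induct)
    case empty
    have "R {} = 0\<^sub>m n n" by (auto simp: R_def)
    then show ?case using zero by simp
  next
    case (insert p S)
    obtain i j where p: "p = (i, j)" and ij: "i < j" "j < n" using insert.prems by auto
    let ?Y = "((R S, 0\<^sub>v n), 0 :: real)"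
    let ?Z = "x $$ (i, j) \<odot>\<^bsub>?L\<^esub> f_elt n (Suc i) (Suc j)"
    have "P ?Z" using ij by (intro smult f f_elt_carrier) auto
    moreover have "?Z \<in> carrier ?L"
      using f_elt_carrier[of n "Suc i" "Suc j"]
      by (auto simp: f_elt_def euclidean_line_simps so_form_smult)
    moreover have "?Y \<in> carrier ?L" using R by (auto simp: euclidean_line_simps)
    ultimately have "P (?Y \<oplus>\<^bsub>?L\<^esub> ?Z)" using insert by (intro add) auto
    moreover have "?Y \<oplus>\<^bsub>?L\<^esub> ?Z = ((R (insert p S), 0\<^sub>v n), 0)"
    proof -
      have "(j, i) \<notin> S" "(i, j) \<notin> S" using insert p ij by auto
      then show ?thesis
        using ij skew_entries[OF xs, of i j]
        by (auto simp: f_elt_def elem_mat_def R_def p euclidean_line_simps mat_eq_iff vec_eq_iff)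
    qed
    ultimately show ?case by simp
  qed
  note ind = this
  have "finite {(i, j). i < j \<and> j < n}"
    by (rule finite_subset[of _ "{..<n} \<times> {..<n}"]) auto
  from ind[OF this order_refl] have m: "P ((x, 0\<^sub>v n), 0)"
  proof -
    have "x $$ (i, i) = 0" if "i < n" for i using skew_entries[OF xs that that] by simp
    then have "R {(i, j). i < j \<and> j < n} = x"
      using xc by (auto simp: R_def mat_eq_iff)
    then show ?thesis using \<open>P ((R {(i, j). i < j \<and> j < n}, 0\<^sub>v n), 0)\<close> by simp
  qed
  have c: "((x, 0\<^sub>v n), 0) \<in> carrier ?L" "((0\<^sub>m n n, u), 0) \<in> carrier ?L"
    "((0\<^sub>m n n, 0\<^sub>v n), t) \<in> carrier ?L" "((x, u), 0) \<in> carrier ?L"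
    using xs u by (auto simp: euclidean_line_simps so_form_zero)
  have "P (((x, 0\<^sub>v n), 0) \<oplus>\<^bsub>?L\<^esub> ((0\<^sub>m n n, u), 0))"
    by (rule add[OF c(1,2) m v])
  then have "P ((x, u), 0)" using xc u by (simp add: euclidean_line_simps)
  then have "P (((x, u), 0) \<oplus>\<^bsub>?L\<^esub> ((0\<^sub>m n n, 0\<^sub>v n), t))"
    by (rule add[OF c(4,3) _ z])
  then show ?thesis using xc u by (simp add: euclidean_line_simps X)
qed

lemma is_J0D:
  assumes "is_J0 k J"
  shows "J \<in> LinearCombinations.module_hom class_ring (euclidean_line_lie (4 * k + 2))
      (euclidean_line_lie (4 * k + 2))"
    and "X \<in> carrier (euclidean_line_lie (4 * k + 2)) \<Longrightarrow>
      J (J X) = \<ominus>\<^bsub>euclidean_line_lie (4 * k + 2)\<^esub> X"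
    and "\<lbrakk>1 \<le> i; i \<le> k\<rbrakk> \<Longrightarrow>
      J (h_elt (4 * k + 2) (2 * i - 1)) = h_elt (4 * k + 2) (2 * i)"
    and "J (h_elt (4 * k + 2) (2 * k + 1)) = central_elt (4 * k + 2)"
    and "\<lbrakk>2 \<le> 2 * j; 2 * j < l; l \<le> 4 * k + 2\<rbrakk> \<Longrightarrow>
      J (f_elt (4 * k + 2) (2 * j - 1) l) = f_elt (4 * k + 2) (2 * j) l"
    and "\<lbrakk>1 \<le> i; i \<le> 2 * k + 1\<rbrakk> \<Longrightarrow>
      J (e_elt (4 * k + 2) (2 * i - 1)) = e_elt (4 * k + 2) (2 * i)"
proof -
  note D = assms[unfolded is_J0_def Let_def]
  note D2 = D[THEN conjunct2] note D3 = D2[THEN conjunct2] note D4 = D3[THEN conjunct2]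
  note D5 = D4[THEN conjunct2] note D6 = D5[THEN conjunct2]
  show "J \<in> LinearCombinations.module_hom class_ring (euclidean_line_lie (4 * k + 2))
      (euclidean_line_lie (4 * k + 2))"
    by (rule D[THEN conjunct1])
  show "J (J X) = \<ominus>\<^bsub>euclidean_line_lie (4 * k + 2)\<^esub> X"
    if "X \<in> carrier (euclidean_line_lie (4 * k + 2))"
    by (rule bspec[OF D2[THEN conjunct1] that])
  show "J (h_elt (4 * k + 2) (2 * i - 1)) = h_elt (4 * k + 2) (2 * i)" if "1 \<le> i" "i \<le> k"
    by (rule D3[THEN conjunct1, rule_format, OF conjI[OF that]])
  show "J (h_elt (4 * k + 2) (2 * k + 1)) = central_elt (4 * k + 2)"
    by (rule D4[THEN conjunct1])
  show "J (f_elt (4 * k + 2) (2 * j - 1) l) = f_elt (4 * k + 2) (2 * j) l"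
    if "2 \<le> 2 * j" "2 * j < l" "l \<le> 4 * k + 2"
    by (rule D5[THEN conjunct1, rule_format, OF conjI[OF that(1) conjI[OF that(2,3)]]])
  show "J (e_elt (4 * k + 2) (2 * i - 1)) = e_elt (4 * k + 2) (2 * i)"
    if "1 \<le> i" "i \<le> 2 * k + 1"
    by (rule D6[rule_format, OF conjI[OF that]])
qed

lemma is_J0_unique:
  assumes J: "is_J0 k J" and J': "is_J0 k J'"
    and X: "X \<in> carrier (euclidean_line_lie (4 * k + 2))"
  shows "J X = J' X"
proof -
  define n where "n = 4 * k + 2"
  let ?L = "euclidean_line_lie n"
  note D = is_J0D[OF J, folded n_def] and D' = is_J0D[OF J', folded n_def]
  note h = D(1) D'(1)
  have step: "J Z = J' Z" if "Y \<in> carrier ?L" "J Y = Z" "J' Y = Z" for Y Z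
    using D(2)[OF that(1)] D'(2)[OF that(1)] that by simp
  have H: "J (h_elt n (2 * i - 1)) = h_elt n (2 * i)" "J' (h_elt n (2 * i - 1)) = h_elt n (2 * i)"
    if "1 \<le> i" "i \<le> k" for i
    by (rule D(3)[OF that], rule D'(3)[OF that])
  have C: "J (h_elt n (2 * k + 1)) = central_elt n" "J' (h_elt n (2 * k + 1)) = central_elt n"
    by (rule D(4), rule D'(4))
  have F: "J (f_elt n (2 * j - 1) l) = f_elt n (2 * j) l"
    "J' (f_elt n (2 * j - 1) l) = f_elt n (2 * j) l"
    if "2 \<le> 2 * j" "2 * j < l" "l \<le> n" for j l
    by (rule D(5)[OF that], rule D'(5)[OF that])
  have E: "J (e_elt n (2 * i - 1)) = e_elt n (2 * i)" "J' (e_elt n (2 * i - 1)) = e_elt n (2 * i)"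
    if "1 \<le> i" "i \<le> 2 * k + 1" for i
    by (rule D(6)[OF that], rule D'(6)[OF that])
  have hc: "h_elt n i \<in> carrier ?L" for i
    unfolding h_elt_def by (rule f_elt_carrier)
  have f: "J (f_elt n i j) = J' (f_elt n i j)" if ij: "1 \<le> i" "i < j" "j \<le> n" for i j
  proof (cases "odd i")
    case True
    define m where "m = Suc (i div 2)"
    have m: "i = 2 * m - 1" using True unfolding m_def by presburger
    have m1: "1 \<le> m" by (simp add: m_def)
    show ?thesis
    proof (cases "j = Suc i")
      case True
      then have "j = 2 * m" using m m1 by linarith
      then have fh: "f_elt n i j = h_elt n m" by (simp add: h_elt_def m)
      have le: "m \<le> 2 * k + 1" using ij m m1 n_def True by linarith
      consider "m = 2 * k + 1" | "even m" "m \<le> 2 * k" | "odd m" "m \<le> 2 * k"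
        using le by linarith
      then show ?thesis
      proof cases
        case 1
        then show ?thesis using C fh by simp
      next
        case 2
        then obtain r where r: "m = 2 * r" by (metis evenE)
        have "1 \<le> r" "r \<le> k" using r 2 m1 by linarith+
        from step[OF hc H[OF this]] show ?thesis by (simp add: fh r)
      next
        case 3
        then obtain r where r: "m = 2 * r + 1" by (metis oddE)
        have "1 \<le> Suc r" "Suc r \<le> k" using r 3 by linarith+
        from H[OF this] show ?thesis by (simp add: fh r)
      qed
    next
      case False
      have "2 \<le> 2 * m" "2 * m < j" using False ij m m1 by linarith+
      from F[OF this ij(3)] show ?thesis by (simp add: m)
    qed
  next
    case False
    then obtain m where m: "i = 2 * m" by (metis evenE)
    have "2 \<le> 2 * m" "2 * m < j" using ij m by auto
    from step[OF f_elt_carrier F[OF this ij(3)]] show ?thesis by (simp add: m)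
  qed
  have e: "J (e_elt n i) = J' (e_elt n i)" if i: "1 \<le> i" "i \<le> n" for i
  proof (cases "odd i")
    case True
    then obtain m where m: "i = 2 * m + 1" by (metis oddE)
    have "1 \<le> Suc m" "Suc m \<le> 2 * k + 1" using i m n_def by auto
    from E[OF this] show ?thesis by (simp add: m)
  next
    case False
    then obtain m where m: "i = 2 * m" by (metis evenE)
    have "1 \<le> m" "m \<le> 2 * k + 1" using i m n_def by auto
    from step[OF e_elt_carrier E[OF this]] show ?thesis by (simp add: m)
  qed
  have c: "J (central_elt n) = J' (central_elt n)"
    by (rule step[OF hc C])
  show ?thesis
  proof (rule euclidean_line_induct[of X n "\<lambda>X. J X = J' X"])
    show "X \<in> carrier ?L" using X by (simp add: n_def)
  next
    fix Y Z assume "Y \<in> carrier ?L" "Z \<in> carrier ?L" "J Y = J' Y" "J Z = J' Z"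
    then show "J (Y \<oplus>\<^bsub>?L\<^esub> Z) = J' (Y \<oplus>\<^bsub>?L\<^esub> Z)"
      by (simp add: LinearCombinations.module_hom_add[OF h(1)]
          LinearCombinations.module_hom_add[OF h(2)])
  next
    fix a Y assume "Y \<in> carrier ?L" "J Y = J' Y"
    then show "J (a \<odot>\<^bsub>?L\<^esub> Y) = J' (a \<odot>\<^bsub>?L\<^esub> Y)"
      by (simp add: LinearCombinations.module_hom_smult[OF h(1)]
          LinearCombinations.module_hom_smult[OF h(2)])
  qed (use e f c in auto)
qed

text \<open>With 0-based \<open>a < b\<close>, the coefficient of \<open>f_elt n (a + 1) (b + 1)\<close> in the image of the
  element with matrix part \<open>x\<close> and central part \<open>t\<close>.\<close>

definition J0_upper :: "nat \<Rightarrow> real mat \<Rightarrow> real \<Rightarrow> nat \<Rightarrow> nat \<Rightarrow> real" where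
  "J0_upper k x t a b =
    (if even a \<and> b = Suc a then
       (if a = 4 * k then - t
        else if even (a div 2) then - x $$ (a + 2, a + 3) else x $$ (a - 2, a - 1))
     else if even a then - x $$ (Suc a, b) else x $$ (a - 1, b))"

definition J0_mat :: "nat \<Rightarrow> real mat \<Rightarrow> real \<Rightarrow> real mat" where
  "J0_mat k x t = mat (4 * k + 2) (4 * k + 2) (\<lambda>(a, b). if a < b then J0_upper k x t a b
    else if b < a then - J0_upper k x t b a else 0)"

definition J0_vec :: "nat \<Rightarrow> real vec \<Rightarrow> real vec" where
  "J0_vec k u = vec (4 * k + 2) (\<lambda>a. if even a then - u $ Suc a else u $ (a - 1))"

definition J0_coord :: "nat \<Rightarrow> (real mat \<times> real vec) \<times> real \<Rightarrow> (real mat \<times> real vec) \<times> real" where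
  "J0_coord k = (\<lambda>((x, u), t). ((J0_mat k x t, J0_vec k u), x $$ (4 * k, Suc (4 * k))))"

lemma so_form_one_eqI:
  assumes A: "A \<in> so_form n (1\<^sub>m n)" and B: "B \<in> so_form n (1\<^sub>m n)"
    and upper: "\<And>a b. a < b \<Longrightarrow> b < n \<Longrightarrow> A $$ (a, b) = B $$ (a, b)"
  shows "A = B"
proof (rule eq_matI)
  note c = so_form_carrier[OF A] so_form_carrier[OF B]
  fix a b assume "a < dim_row B" "b < dim_col B"
  then have l: "a < n" "b < n" using c by auto
  consider "a < b" | "a = b" | "b < a" by linarith
  then show "A $$ (a, b) = B $$ (a, b)"
  proof cases
    case 1
    then show ?thesis using upper l by blast
  next
    case 2
    then show ?thesis using skew_entries[OF A l] skew_entries[OF B l] by simp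
  next
    case 3
    then show ?thesis using upper[OF 3 l(1)] skew_entries[OF A l] skew_entries[OF B l] by simp
  qed
qed (use so_form_carrier[OF A] so_form_carrier[OF B] in auto)

lemma J0_mat_so: "J0_mat k x t \<in> so_form (4 * k + 2) (1\<^sub>m (4 * k + 2))"
  by (rule so_form_oneI) (auto simp: J0_mat_def)

lemma J0_mat_upper:
  "\<lbrakk>a < b; b < 4 * k + 2\<rbrakk> \<Longrightarrow> J0_mat k x t $$ (a, b) = J0_upper k x t a b"
  by (simp add: J0_mat_def)

lemma even_bound: "\<lbrakk>even a; Suc a < 4 * k + 2; a \<noteq> 4 * k; even (a div 2)\<rbrakk> \<Longrightarrow> a + 3 < 4 * k + (2 :: nat)"
  by presburger

lemma J0_vec_entry:
  "a < 4 * k + 2 \<Longrightarrow> J0_vec k u $ a = (if even a then - u $ Suc a else u $ (a - 1))"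
  by (simp add: J0_vec_def)

lemma J0_vec_dim: "dim_vec (J0_vec k u) = 4 * k + 2"
  by (simp add: J0_vec_def)

lemma even_bound_Suc: "\<lbrakk>even a; a < 4 * k + 2\<rbrakk> \<Longrightarrow> Suc a < 4 * k + (2 :: nat)"
  by presburger

lemma J0_vec_add:
  assumes "u \<in> carrier_vec (4 * k + 2)" "v \<in> carrier_vec (4 * k + 2)"
  shows "J0_vec k (u + v) = J0_vec k u + J0_vec k v"
proof (rule eq_vecI)
  fix a assume "a < dim_vec (J0_vec k u + J0_vec k v)"
  then have a: "a < 4 * k + 2" by (simp add: J0_vec_dim)
  then show "J0_vec k (u + v) $ a = (J0_vec k u + J0_vec k v) $ a"
    using assms even_bound_Suc[OF _ a] by (simp add: J0_vec_entry J0_vec_dim)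
qed (simp add: J0_vec_dim)

lemma J0_vec_smult:
  assumes "u \<in> carrier_vec (4 * k + 2)"
  shows "J0_vec k (c \<cdot>\<^sub>v u) = c \<cdot>\<^sub>v J0_vec k u"
proof (rule eq_vecI)
  fix a assume "a < dim_vec (c \<cdot>\<^sub>v J0_vec k u)"
  then have a: "a < 4 * k + 2" by (simp add: J0_vec_dim)
  then show "J0_vec k (c \<cdot>\<^sub>v u) $ a = (c \<cdot>\<^sub>v J0_vec k u) $ a"
    using assms even_bound_Suc[OF _ a] by (simp add: J0_vec_entry J0_vec_dim)
qed (simp add: J0_vec_dim)

lemma J0_vec_square:
  assumes "u \<in> carrier_vec (4 * k + 2)"
  shows "J0_vec k (J0_vec k u) = - u"
proof (rule eq_vecI)
  fix a assume "a < dim_vec (- u)"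
  then have a: "a < 4 * k + 2" using assms by simp
  show "J0_vec k (J0_vec k u) $ a = (- u) $ a"
  proof (cases "even a")
    case True
    then show ?thesis
      using assms a even_bound_Suc[OF _ a] by (simp add: J0_vec_entry)
  next
    case False
    then obtain r where r: "a = Suc (2 * r)" by (metis oddE Suc_eq_plus1)
    then show ?thesis using assms a by (simp add: J0_vec_entry)
  qed
qed (use assms in \<open>simp add: J0_vec_dim\<close>)

lemma J0_upper_add:
  assumes "x \<in> carrier_mat (4 * k + 2) (4 * k + 2)" "y \<in> carrier_mat (4 * k + 2) (4 * k + 2)"
    and "a < b" "b < 4 * k + 2"
  shows "J0_upper k (x + y) (s + t) a b = J0_upper k x s a b + J0_upper k y t a b"
  using assms even_bound[of a k] by (auto simp: J0_upper_def)

lemma J0_upper_smult: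
  assumes "x \<in> carrier_mat (4 * k + 2) (4 * k + 2)" "a < b" "b < 4 * k + 2"
  shows "J0_upper k (c \<cdot>\<^sub>m x) (c * s) a b = c * J0_upper k x s a b"
  using assms even_bound[of a k] by (auto simp: J0_upper_def)

lemma J0_mat_add:
  assumes "x \<in> carrier_mat (4 * k + 2) (4 * k + 2)" "y \<in> carrier_mat (4 * k + 2) (4 * k + 2)"
  shows "J0_mat k (x + y) (s + t) = J0_mat k x s + J0_mat k y t"
  by (rule so_form_one_eqI[OF J0_mat_so so_form_add[OF one_carrier_mat J0_mat_so J0_mat_so]])
    (use J0_upper_add[OF assms] in \<open>simp add: J0_mat_def\<close>)

lemma J0_mat_smult:
  assumes "x \<in> carrier_mat (4 * k + 2) (4 * k + 2)"
  shows "J0_mat k (c \<cdot>\<^sub>m x) (c * s) = c \<cdot>\<^sub>m J0_mat k x s"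
  by (rule so_form_one_eqI[OF J0_mat_so so_form_smult[OF one_carrier_mat J0_mat_so]])
    (use J0_upper_smult[OF assms] in \<open>simp add: J0_mat_def\<close>)

lemma J0_coord_hom:
  "J0_coord k \<in> LinearCombinations.module_hom class_ring (euclidean_line_lie (4 * k + 2))
    (euclidean_line_lie (4 * k + 2))"
  unfolding LinearCombinations.module_hom_def
proof (intro CollectI conjI allI impI)
  show "J0_coord k \<in> carrier (euclidean_line_lie (4 * k + 2)) \<rightarrow>
      carrier (euclidean_line_lie (4 * k + 2))"
    using J0_mat_so by (auto simp: euclidean_line_simps J0_coord_def J0_vec_def)
next
  fix X Y
  assume XY: "X \<in> carrier (euclidean_line_lie (4 * k + 2)) \<and>
    Y \<in> carrier (euclidean_line_lie (4 * k + 2))"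
  obtain x u s y v t where d: "X = ((x, u), s)" "Y = ((y, v), t)" by (metis surj_pair)
  have c: "x \<in> carrier_mat (4 * k + 2) (4 * k + 2)" "y \<in> carrier_mat (4 * k + 2) (4 * k + 2)"
    "u \<in> carrier_vec (4 * k + 2)" "v \<in> carrier_vec (4 * k + 2)"
    using XY so_form_carrier by (auto simp: d euclidean_line_simps)
  show "J0_coord k (X \<oplus>\<^bsub>euclidean_line_lie (4 * k + 2)\<^esub> Y) =
      J0_coord k X \<oplus>\<^bsub>euclidean_line_lie (4 * k + 2)\<^esub> J0_coord k Y"
    using c by (simp add: d euclidean_line_simps J0_coord_def J0_mat_add J0_vec_add)
next
  fix c :: real and X
  assume X: "c \<in> carrier class_ring \<and> X \<in> carrier (euclidean_line_lie (4 * k + 2))"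
  obtain x u s where d: "X = ((x, u), s)" by (metis surj_pair)
  have e: "x \<in> carrier_mat (4 * k + 2) (4 * k + 2)" "u \<in> carrier_vec (4 * k + 2)"
    using X so_form_carrier by (auto simp: d euclidean_line_simps)
  show "J0_coord k (c \<odot>\<^bsub>euclidean_line_lie (4 * k + 2)\<^esub> X) =
      c \<odot>\<^bsub>euclidean_line_lie (4 * k + 2)\<^esub> J0_coord k X"
    using e by (simp add: d euclidean_line_simps J0_coord_def J0_mat_smult J0_vec_smult)
qed

lemma J0_upper_square:
  assumes "a < b" "b < 4 * k + 2"
  shows "J0_upper k (J0_mat k x t) (x $$ (4 * k, Suc (4 * k))) a b = - x $$ (a, b)"
proof -
  let ?M = "J0_mat k x t"
  consider (last) "a = 4 * k" "b = Suc a"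
    | (h1) "even a" "b = Suc a" "a \<noteq> 4 * k" "even (a div 2)"
    | (h2) "even a" "b = Suc a" "a \<noteq> 4 * k" "odd (a div 2)"
    | (ev) "even a" "b \<noteq> Suc a" | (od) "odd a"
    by blast
  then show ?thesis
  proof cases
    case h1
    have "a + 3 < 4 * k + 2" using even_bound[OF h1(1) _ h1(3,4)] assms h1 by simp
    moreover have "odd (Suc (a div 2))" "Suc (Suc a) \<noteq> 4 * k" using h1 by presburger+
    ultimately have "?M $$ (a + 2, a + 3) = x $$ (a, Suc a)"
      using h1 J0_mat_upper[of "a + 2" "a + 3" k x t] by (simp add: J0_upper_def)
    then show ?thesis using h1 by (simp add: J0_upper_def)
  next
    case h2
    then have "a = 4 * (a div 4) + 2" by presburger
    then obtain r where r: "a = 4 * r + 2" by blast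
    have "?M $$ (4 * r, Suc (4 * r)) = - x $$ (a, Suc a)"
      using assms h2 r J0_mat_upper[of "4 * r" "Suc (4 * r)" k x t]
      by (simp add: J0_upper_def numeral_3_eq_3)
    then show ?thesis using h2 r by (simp add: J0_upper_def)
  next
    case ev
    then have "Suc a < b" using assms by simp
    then have "?M $$ (Suc a, b) = x $$ (a, b)"
      using assms ev J0_mat_upper[of "Suc a" b k x t] by (simp add: J0_upper_def)
    then show ?thesis using ev by (simp add: J0_upper_def)
  next
    case od
    then obtain r where r: "a = Suc (2 * r)" by (metis oddE Suc_eq_plus1)
    have "?M $$ (2 * r, b) = - x $$ (a, b)"
      using assms r J0_mat_upper[of "2 * r" b k x t] by (simp add: J0_upper_def)
    then show ?thesis using r by (simp add: J0_upper_def)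
  qed (simp add: J0_upper_def)
qed

lemma J0_coord_square:
  assumes X: "X \<in> carrier (euclidean_line_lie (4 * k + 2))"
  shows "J0_coord k (J0_coord k X) = \<ominus>\<^bsub>euclidean_line_lie (4 * k + 2)\<^esub> X"
proof -
  obtain x u t where d: "X = ((x, u), t)" by (metis surj_pair)
  have xs: "x \<in> so_form (4 * k + 2) (1\<^sub>m (4 * k + 2))" and u: "u \<in> carrier_vec (4 * k + 2)"
    using X by (auto simp: d euclidean_line_simps)
  note xc = so_form_carrier[OF xs]
  have "J0_mat k (J0_mat k x t) (x $$ (4 * k, Suc (4 * k))) = (- 1) \<cdot>\<^sub>m x"
    by (rule so_form_one_eqI[OF J0_mat_so so_form_smult[OF one_carrier_mat xs]])
      (use J0_upper_square xc in \<open>simp add: J0_mat_upper\<close>)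
  then have "J0_mat k (J0_mat k x t) (x $$ (4 * k, Suc (4 * k))) = - x"
    using xc by (simp add: mat_eq_iff)
  moreover have "J0_vec k (J0_vec k u) = - u"
    by (rule J0_vec_square[OF u])
  moreover have "J0_mat k x t $$ (4 * k, Suc (4 * k)) = - t"
    by (simp add: J0_mat_upper J0_upper_def)
  ultimately show ?thesis
    using X by (simp add: d euclidean_line_uminus) (simp add: J0_coord_def)
qed

lemma f_upper:
  assumes "i < j" "a < b" "b < n"
  shows "(elem_mat n i j - elem_mat n j i) $$ (a, b) = (if Suc a = i \<and> Suc b = j then 1 else 0)"
  using assms elem_mat_diff_entry[of a n b i j] by auto

lemma J0_upper_f:
  assumes ij: "i < j" and ab: "a < b" "b < 4 * k + 2"
  shows "J0_upper k (elem_mat (4 * k + 2) i j - elem_mat (4 * k + 2) j i) t a b =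
    (if even a \<and> b = Suc a then
       (if a = 4 * k then - t
        else if even (a div 2) then - (if a + 3 = i \<and> a + 4 = j then 1 else 0)
        else if a - 1 = i \<and> a = j then 1 else 0)
     else if even a then - (if a + 2 = i \<and> Suc b = j then 1 else 0)
     else if a = i \<and> Suc b = j then 1 else 0)"
proof -
  let ?n = "4 * k + 2"
  note f = f_upper[OF ij, of _ _ ?n]
  consider (last) "a = 4 * k" "b = Suc a"
    | (h1) "even a" "b = Suc a" "a \<noteq> 4 * k" "even (a div 2)"
    | (h2) "even a" "b = Suc a" "a \<noteq> 4 * k" "odd (a div 2)"
    | (ev) "even a" "b \<noteq> Suc a" | (od) "odd a"
    by blast
  then show ?thesis
  proof cases
    case h1
    then show ?thesis
      using even_bound[OF h1(1) _ h1(3,4)] ab f[of "a + 2" "a + 3"] by (simp add: J0_upper_def)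
  next
    case h2
    then have "a = 4 * (a div 4) + 2" by presburger
    then obtain r where r: "a = 4 * r + 2" by blast
    show ?thesis
      using h2 ab f[of "4 * r" "Suc (4 * r)"] by (simp add: J0_upper_def r)
  next
    case ev
    then show ?thesis using ab f[of "Suc a" b] by (simp add: J0_upper_def)
  next
    case od
    then obtain r where r: "a = Suc (2 * r)" by (metis oddE Suc_eq_plus1)
    show ?thesis using od ab f[of "2 * r" b] by (simp add: J0_upper_def r)
  qed (simp add: J0_upper_def)
qed

lemma J0_coord_is_J0: "is_J0 k (J0_coord k)"
proof -
  define n where "n = 4 * k + 2"
  have v0: "J0_vec k (0\<^sub>v n) = 0\<^sub>v n"
  proof (rule eq_vecI)
    fix a assume "a < dim_vec (0\<^sub>v n :: real vec)"
    then have a: "a < 4 * k + 2" by (simp add: n_def)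
    then show "J0_vec k (0\<^sub>v n) $ a = 0\<^sub>v n $ a"
      using even_bound_Suc[OF _ a] by (simp add: J0_vec_entry n_def)
  qed (simp add: J0_vec_dim n_def)
  have f: "J0_coord k (f_elt n i j) = f_elt n i' j'"
    if ij: "i < j" "i' < j'" and ne: "\<not> (i = 4 * k + 1 \<and> j = 4 * k + 2)"
      and eq: "\<And>a b. \<lbrakk>a < b; b < n\<rbrakk> \<Longrightarrow>
        J0_upper k (elem_mat n i j - elem_mat n j i) 0 a b = (if Suc a = i' \<and> Suc b = j' then 1 else 0)"
    for i j i' j'
  proof -
    have "J0_mat k (elem_mat n i j - elem_mat n j i) 0 = elem_mat n i' j' - elem_mat n j' i'"
    proof (rule so_form_one_eqI[OF J0_mat_so[of k, folded n_def] f_so])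
      fix a b assume ab: "a < b" "b < n"
      then show "J0_mat k (elem_mat n i j - elem_mat n j i) 0 $$ (a, b)
          = (elem_mat n i' j' - elem_mat n j' i') $$ (a, b)"
        using J0_mat_upper[OF ab[unfolded n_def]] f_upper[OF ij(2) ab] eq[OF ab] by simp
    qed
    moreover have "(elem_mat n i j - elem_mat n j i) $$ (4 * k, Suc (4 * k)) = 0"
      using ne f_upper[OF ij(1), of "4 * k" "Suc (4 * k)" n] by (auto simp: n_def)
    ultimately show ?thesis by (simp add: f_elt_def J0_coord_def v0)
  qed
  have h: "J0_coord k (h_elt n (2 * i - 1)) = h_elt n (2 * i)" if i: "1 \<le> i" "i \<le> k" for i
    unfolding h_elt_def
  proof (rule f)
    fix a b assume ab: "a < b" "b < n"
    obtain r where r: "i = Suc r" using i by (cases i) auto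
    have "2 * (2 * i - 1) - 1 < 2 * (2 * i - 1)" using i by simp
    from J0_upper_f[OF this ab[unfolded n_def], of 0]
    show "J0_upper k (elem_mat n (2 * (2 * i - 1) - 1) (2 * (2 * i - 1))
        - elem_mat n (2 * (2 * i - 1)) (2 * (2 * i - 1) - 1)) 0 a b
        = (if Suc a = 2 * (2 * i) - 1 \<and> Suc b = 2 * (2 * i) then 1 else 0)"
      unfolding n_def r using ab i r by (auto split: if_splits) presburger+
  qed (use i in auto)
  have c: "J0_coord k (h_elt n (2 * k + 1)) = central_elt n"
  proof -
    have e: "2 * (2 * k + 1) - 1 = 4 * k + 1" "2 * (2 * k + 1) = 4 * k + 2" by simp_all
    have "J0_mat k (elem_mat n (4 * k + 1) (4 * k + 2) - elem_mat n (4 * k + 2) (4 * k + 1)) 0 = 0\<^sub>m n n"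
    proof (rule so_form_one_eqI[OF J0_mat_so[of k, folded n_def] so_form_zero[OF one_carrier_mat]])
      fix a b assume ab: "a < b" "b < n"
      have "4 * k + 1 < 4 * k + 2" by simp
      from J0_upper_f[OF this ab[unfolded n_def], of 0]
      have "J0_upper k (elem_mat n (4 * k + 1) (4 * k + 2) - elem_mat n (4 * k + 2) (4 * k + 1)) 0 a b = 0"
        unfolding n_def using ab n_def by (auto split: if_splits) presburger+
      then show "J0_mat k (elem_mat n (4 * k + 1) (4 * k + 2) - elem_mat n (4 * k + 2) (4 * k + 1)) 0
          $$ (a, b) = 0\<^sub>m n n $$ (a, b)"
        using J0_mat_upper[OF ab[unfolded n_def]] ab by simp
    qed
    moreover have "(elem_mat n (4 * k + 1) (4 * k + 2) - elem_mat n (4 * k + 2) (4 * k + 1))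
        $$ (4 * k, Suc (4 * k)) = 1"
      by (simp add: elem_mat_def n_def)
    ultimately show ?thesis
      unfolding h_elt_def e by (simp add: f_elt_def central_elt_def J0_coord_def v0)
  qed
  have t: "J0_coord k (f_elt n (2 * j - 1) l) = f_elt n (2 * j) l"
    if jl: "2 \<le> 2 * j" "2 * j < l" "l \<le> n" for j l
  proof (rule f)
    fix a b assume ab: "a < b" "b < n"
    obtain q where q: "j = Suc q" using jl by (cases j) auto
    have "2 * j - 1 < l" using jl by simp
    from J0_upper_f[OF this ab[unfolded n_def], of 0]
    show "J0_upper k (elem_mat n (2 * j - 1) l - elem_mat n l (2 * j - 1)) 0 a b
        = (if Suc a = 2 * j \<and> Suc b = l then 1 else 0)"
      unfolding n_def q using ab jl q by (auto split: if_splits) presburger+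
  qed (use jl in auto)
  have e: "J0_coord k (e_elt n (2 * i - 1)) = e_elt n (2 * i)" if i: "1 \<le> i" "i \<le> 2 * k + 1" for i
  proof -
    have "J0_vec k (unit_vec n (2 * i - 1 - 1)) = unit_vec n (2 * i - 1)"
    proof (rule eq_vecI)
      fix a assume "a < dim_vec (unit_vec n (2 * i - 1))"
      then have a: "a < 4 * k + 2" by (simp add: n_def)
      obtain q where q: "i = Suc q" using i by (cases i) auto
      show "J0_vec k (unit_vec n (2 * i - 1 - 1)) $ a = unit_vec n (2 * i - 1) $ a"
      proof (cases "even a")
        case True
        then have "Suc a \<noteq> 2 * q" "a \<noteq> Suc (2 * q)" by presburger+
        then show ?thesis
          using True a even_bound_Suc[OF True a] by (simp add: J0_vec_entry q n_def unit_vec_def)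
      next
        case False
        then obtain r where "a = Suc (2 * r)" by (metis oddE Suc_eq_plus1)
        then show ?thesis using a by (simp add: J0_vec_entry q n_def unit_vec_def)
      qed
    qed (simp add: J0_vec_def n_def)
    moreover have "J0_mat k (0\<^sub>m n n) 0 = 0\<^sub>m n n"
      using J0_mat_smult[of "0\<^sub>m n n" k 0 0] J0_mat_so[of k "0\<^sub>m n n" 0, THEN so_form_carrier]
      by (auto simp: n_def mat_eq_iff)
    ultimately show ?thesis by (simp add: e_elt_def J0_coord_def n_def)
  qed
  show ?thesis
    unfolding is_J0_def Let_def
    using J0_coord_hom[of k] J0_coord_square[of _ k] h c t e by (auto simp: n_def)
qed

lemma is_J0_restrict:
  assumes "is_J0 k J"
  shows "is_J0 k (restrict J (carrier (euclidean_line_lie (4 * k + 2))))"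
proof -
  let ?L = "euclidean_line_lie (4 * k + 2)"
  let ?R = "restrict J (carrier ?L)"
  interpret L: real_lie_algebra ?L by (rule euclidean_line_lie_algebra)
  note D = is_J0D[OF assms]
  have cl: "J X \<in> carrier ?L" if "X \<in> carrier ?L" for X
    using LinearCombinations.module_hom_closed[OF D(1)] that by blast
  have R: "?R X = J X" if "X \<in> carrier ?L" for X using that by simp
  have hc: "h_elt n i \<in> carrier (euclidean_line_lie n)" for n i
    unfolding h_elt_def by (rule f_elt_carrier)
  have "?R \<in> LinearCombinations.module_hom class_ring ?L ?L"
    unfolding LinearCombinations.module_hom_def
  proof (intro CollectI conjI allI impI)
    show "?R \<in> carrier ?L \<rightarrow> carrier ?L" using cl by simp
  next
    fix X Y assume "X \<in> carrier ?L \<and> Y \<in> carrier ?L"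
    then show "?R (X \<oplus>\<^bsub>?L\<^esub> Y) = ?R X \<oplus>\<^bsub>?L\<^esub> ?R Y"
      using LinearCombinations.module_hom_add[OF D(1)] L.a_closed[of X Y] by (simp add: R)
  next
    fix c X assume "c \<in> carrier (class_ring :: real ring) \<and> X \<in> carrier ?L"
    then show "?R (c \<odot>\<^bsub>?L\<^esub> X) = c \<odot>\<^bsub>?L\<^esub> ?R X"
      using LinearCombinations.module_hom_smult[OF D(1)] L.smult_closed[of c X] by (simp add: R)
  qed
  moreover have "?R (?R X) = \<ominus>\<^bsub>?L\<^esub> X" if "X \<in> carrier ?L" for X
    using D(2)[OF that] R[OF that] R[OF cl[OF that]] by simp
  ultimately show ?thesis
    unfolding is_J0_def Let_def
    using D(3-6) by (auto simp only: R[OF hc] R[OF f_elt_carrier] R[OF e_elt_carrier])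
qed

lemma J0_ex1: "\<exists>!J. J \<in> extensional (carrier (euclidean_line_lie (4 * k + 2))) \<and> is_J0 k J"
proof (rule ex_ex1I)
  show "\<exists>J. J \<in> extensional (carrier (euclidean_line_lie (4 * k + 2))) \<and> is_J0 k J"
    using is_J0_restrict[OF J0_coord_is_J0] restrict_extensional by blast
next
  fix J J'
  assume "J \<in> extensional (carrier (euclidean_line_lie (4 * k + 2))) \<and> is_J0 k J"
    and "J' \<in> extensional (carrier (euclidean_line_lie (4 * k + 2))) \<and> is_J0 k J'"
  then show "J = J'" using is_J0_unique by (blast intro: extensionalityI)
qed

lemma J0_is_J0: "is_J0 k (J0 k)"
  using theI'[OF J0_ex1] by (simp add: J0_def)

lemma J0_eq_coord: "X \<in> carrier (euclidean_line_lie (4 * k + 2)) \<Longrightarrow> J0 k X = J0_coord k X"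
  by (rule is_J0_unique[OF J0_is_J0 J0_coord_is_J0])

end

theory Submission
  imports Defs
begin

text \<open>
  An endomorphism \<open>J\<close> with \<open>J\<^sup>2 = -1\<close> is integrable exactly when the complex subspace
  \<open>q = {X - \<i> J X}\<close> of the complexified Lie algebra is closed under the bracket, and \<open>J\<close> can be
  read off from \<open>q\<close>, since \<open>X - \<i> Y\<close> with \<open>X\<close>, \<open>Y\<close> real lies in \<open>q\<close> if and only if \<open>Y = J X\<close>. The
  proof therefore exhibits \<open>q\<close>; linearity of \<open>J\<close>, \<open>J\<^sup>2 = -1\<close> and integrability all come from \<open>q\<close>
  being a complex subalgebra that is the graph of a map (\<open>complex_structure_of_graph\<close>).

  Put \<open>n = 4 k + 2\<close>, let \<open>e\<close> be the time-like basis vector, and let \<open>z\<^sub>j\<close> be the \<open>j\<close>-th space-like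
  pair combined to (first vector) \<open>- \<i>\<close> (second vector). These \<open>n / 2\<close> vectors span an isotropic
  flag \<open>F\<^sub>1 \<subset> F\<^sub>2 \<subset> \<dots>\<close>, whose largest member \<open>F\<close> has orthogonal complement \<open>F + \<complex> e\<close>. The elements
  that \<open>J\<^sup>0\<close> prescribes, namely \<open>z\<^sub>j \<and> e\<^sub>l\<close> for \<open>l\<close> beyond the \<open>j\<close>-th pair, \<open>h\<^sub>2\<^sub>i\<^sub>-\<^sub>1 - \<i> h\<^sub>2\<^sub>i\<close>, \<open>h\<^sub>2\<^sub>k\<^sub>+\<^sub>1 - \<i> e\<close> and the vectors \<open>z\<^sub>j\<close>, are
  completed by the boosts \<open>z\<^sub>j \<and> e\<close>. The resulting space \<open>q\<close> consists of the pairs \<open>(M, w)\<close> where \<open>M\<close>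
  stabilizes the flag (a Borel subalgebra), the eigenvalues of \<open>M\<close> on the quotients of the flag obey
  the linear relations coming from the \<open>h\<^sub>i\<close>, and \<open>w\<close> lies in the complement of \<open>F\<close> with an
  \<open>e\<close>-component proportional to the last eigenvalue.

  This is a subalgebra: a commutator of elements of a Borel subalgebra has all eigenvalues zero, \<open>M\<close>
  preserves the complement of \<open>F\<close> because it preserves \<open>F\<close>, and \<open>M\<close> acts by zero on the
  one-dimensional quotient of this complement by \<open>F\<close> because \<open>M\<close> is skew. In coordinates each of
  these facts is a cancellation between the two indices of a pair, which holds because
  \<open>(- \<i>)\<^sup>2 = - 1\<close> (\<open>relations_apply\<close>, \<open>relations_diagonal\<close>, \<open>relations_time_component\<close>).

  On the image of the block embedding the structure so obtained is \<open>J\<^sup>0\<close> by construction. As the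
  embedding is injective, the integrability of \<open>J\<^sup>0\<close> itself then follows by pulling back
  (\<open>complex_structure_pullback\<close>).
\<close>

section \<open>Criteria for complex structures\<close>

text \<open>Read \<open>G x y\<close> as \<open>x - \<i> y \<in> q\<close> for a subset \<open>q\<close> of the complexification. The closure hypotheses
  then say that \<open>q\<close> is a complex subalgebra, \<open>times_i\<close> being multiplication by \<open>\<i>\<close> and \<open>bracket\<close>
  the expansion of \<open>[x - \<i> y, x' - \<i> y']\<close>. Vanishing of the Nijenhuis expression is the last closure
  property applied to \<open>x - \<i> J x\<close> and \<open>y - \<i> J y\<close>.\<close>

lemma complex_structure_of_graph:
  fixes L :: "('a, 'b) real_lie_scheme" (structure)
  assumes L: "real_lie_algebra L"
    and closed: "\<And>x. x \<in> carrier L \<Longrightarrow> J x \<in> carrier L"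
    and graph: "\<And>x y. \<lbrakk>x \<in> carrier L; y \<in> carrier L\<rbrakk> \<Longrightarrow> G x y \<longleftrightarrow> y = J x"
    and add: "\<And>x y x' y'. \<lbrakk>x \<in> carrier L; y \<in> carrier L; x' \<in> carrier L; y' \<in> carrier L;
      G x y; G x' y'\<rbrakk> \<Longrightarrow> G (x \<oplus> x') (y \<oplus> y')"
    and smult: "\<And>c x y. \<lbrakk>x \<in> carrier L; y \<in> carrier L; G x y\<rbrakk> \<Longrightarrow> G (c \<odot> x) (c \<odot> y)"
    and times_i: "\<And>x y. \<lbrakk>x \<in> carrier L; y \<in> carrier L; G x y\<rbrakk> \<Longrightarrow> G y (\<ominus> x)"
    and bracket: "\<And>x y x' y'. \<lbrakk>x \<in> carrier L; y \<in> carrier L; x' \<in> carrier L; y' \<in> carrier L;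
      G x y; G x' y'\<rbrakk> \<Longrightarrow>
      G (bracket L x x' \<ominus> bracket L y y') (bracket L x y' \<oplus> bracket L y x')"
  shows "complex_structure L J"
proof -
  interpret L: real_lie_algebra L by fact
  have G: "G x (J x)" if "x \<in> carrier L" for x
    using graph closed that by blast
  have J_add: "J (x \<oplus> y) = J x \<oplus> J y" if "x \<in> carrier L" "y \<in> carrier L" for x y
    using add[OF that(1) closed[OF that(1)] that(2) closed[OF that(2)] G G] that closed
    by (simp add: graph)
  have J_smult: "J (c \<odot> x) = c \<odot> J x" if "x \<in> carrier L" for c x
    using smult[OF that closed[OF that] G[OF that]] that closed by (simp add: graph)
  have J_square: "J (J x) = \<ominus> x" if "x \<in> carrier L" for x
    using times_i[OF that closed[OF that] G[OF that]] that closed by (simp add: graph)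
  have J_minus: "J (\<ominus> x) = \<ominus> J x" if "x \<in> carrier L" for x
    using J_square[OF that] J_square[OF closed[OF that]] by simp
  have nijenhuis: "J (bracket L x y) \<ominus> bracket L (J x) y \<ominus> bracket L x (J y)
      \<ominus> J (bracket L (J x) (J y)) = \<zero>"
    if xy: "x \<in> carrier L" "y \<in> carrier L" for x y
  proof -
    note c = L.bracket_closed[OF xy] L.bracket_closed[OF closed[OF xy(1)] xy(2)]
      L.bracket_closed[OF xy(1) closed[OF xy(2)]]
      L.bracket_closed[OF closed[OF xy(1)] closed[OF xy(2)]]
    have e: "bracket L x (J y) \<oplus> bracket L (J x) y
        = J (bracket L x y) \<oplus> \<ominus> J (bracket L (J x) (J y))"
      using bracket[OF xy(1) closed[OF xy(1)] xy(2) closed[OF xy(2)] G[OF xy(1)] G[OF xy(2)]] c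
      by (simp add: graph a_minus_def J_add J_minus)
    define p q r s where "p = J (bracket L x y)" and "q = bracket L (J x) y"
      and "r = bracket L x (J y)" and "s = J (bracket L (J x) (J y))"
    have pqrs: "p \<in> carrier L" "q \<in> carrier L" "r \<in> carrier L" "s \<in> carrier L"
      using c closed by (auto simp: p_def q_def r_def s_def)
    have "p \<ominus> q \<ominus> r \<ominus> s = (p \<oplus> \<ominus> s) \<oplus> \<ominus> (r \<oplus> q)"
      using pqrs by (simp add: a_minus_def L.minus_add L.a_ac)
    also have "\<dots> = \<zero>"
      using e pqrs by (simp add: p_def[symmetric] q_def[symmetric] r_def[symmetric]
          s_def[symmetric] L.r_neg)
    finally show ?thesis by (simp add: p_def q_def r_def s_def)
  qed
  have "J \<in> LinearCombinations.module_hom class_ring L L"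
    unfolding LinearCombinations.module_hom_def using closed J_add J_smult by auto
  with L J_square nijenhuis show ?thesis by (simp add: complex_structure_def)
qed

text \<open>Every condition is an identity between elements, so injectivity of the embedding transports it
  back; even the linearity of \<open>J\<close> comes for free.\<close>

lemma complex_structure_pullback:
  assumes emb: "lie_embedding L M \<phi>" and M: "complex_structure M J'"
    and closed: "\<And>x. x \<in> carrier L \<Longrightarrow> J x \<in> carrier L"
    and comm: "\<And>x. x \<in> carrier L \<Longrightarrow> \<phi> (J x) = J' (\<phi> x)"
  shows "complex_structure L J"
proof -
  interpret L: real_lie_algebra L using emb by (simp add: lie_embedding_def)
  interpret M: real_lie_algebra M using emb by (simp add: lie_embedding_def)
  have hom: "\<phi> \<in> LinearCombinations.module_hom class_ring L M" and inj: "inj_on \<phi> (carrier L)"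
    and br: "\<And>x y. \<lbrakk>x \<in> carrier L; y \<in> carrier L\<rbrakk> \<Longrightarrow> \<phi> (bracket L x y) = bracket M (\<phi> x) (\<phi> y)"
    using emb by (auto simp: lie_embedding_def)
  have hom': "J' \<in> LinearCombinations.module_hom class_ring M M"
    and sq: "\<And>x. x \<in> carrier M \<Longrightarrow> J' (J' x) = \<ominus>\<^bsub>M\<^esub> x"
    and nij: "\<And>x y. \<lbrakk>x \<in> carrier M; y \<in> carrier M\<rbrakk> \<Longrightarrow>
      J' (bracket M x y) \<ominus>\<^bsub>M\<^esub> bracket M (J' x) y \<ominus>\<^bsub>M\<^esub> bracket M x (J' y)
        \<ominus>\<^bsub>M\<^esub> J' (bracket M (J' x) (J' y)) = \<zero>\<^bsub>M\<^esub>"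
    using M by (auto simp: complex_structure_def)
  have add: "\<phi> (x \<oplus>\<^bsub>L\<^esub> y) = \<phi> x \<oplus>\<^bsub>M\<^esub> \<phi> y" if "x \<in> carrier L" "y \<in> carrier L" for x y
    by (rule LinearCombinations.module_hom_add[OF hom that])
  have smult: "\<phi> (c \<odot>\<^bsub>L\<^esub> x) = c \<odot>\<^bsub>M\<^esub> \<phi> x" if "x \<in> carrier L" for c x
    using LinearCombinations.module_hom_smult[OF hom _ that] by simp
  have cl: "\<phi> x \<in> carrier M" if "x \<in> carrier L" for x
    using LinearCombinations.module_hom_closed[OF hom] that by blast
  have cl': "J' x \<in> carrier M" if "x \<in> carrier M" for x
    using LinearCombinations.module_hom_closed[OF hom'] that by blast
  have add': "J' (x \<oplus>\<^bsub>M\<^esub> y) = J' x \<oplus>\<^bsub>M\<^esub> J' y" if "x \<in> carrier M" "y \<in> carrier M" for x y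
    by (rule LinearCombinations.module_hom_add[OF hom' that])
  have smult': "J' (c \<odot>\<^bsub>M\<^esub> x) = c \<odot>\<^bsub>M\<^esub> J' x" if "x \<in> carrier M" for c x
    using LinearCombinations.module_hom_smult[OF hom' _ that] by simp
  have zero: "\<phi> \<zero>\<^bsub>L\<^esub> = \<zero>\<^bsub>M\<^esub>"
    using smult[of "\<zero>\<^bsub>L\<^esub>" 0] cl[of "\<zero>\<^bsub>L\<^esub>"] L.lmult_0[of "\<zero>\<^bsub>L\<^esub>"]
      M.lmult_0[of "\<phi> \<zero>\<^bsub>L\<^esub>"] by simp
  have minus: "\<phi> (\<ominus>\<^bsub>L\<^esub> x) = \<ominus>\<^bsub>M\<^esub> \<phi> x" if "x \<in> carrier L" for x
    using add[of "\<ominus>\<^bsub>L\<^esub> x" x] that cl zero by (intro M.minus_equality[symmetric]) (auto simp: L.l_neg)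
  have eqI: "x = y" if "\<phi> x = \<phi> y" "x \<in> carrier L" "y \<in> carrier L" for x y
    using inj that by (auto simp: inj_on_def)
  have "J (x \<oplus>\<^bsub>L\<^esub> y) = J x \<oplus>\<^bsub>L\<^esub> J y" if "x \<in> carrier L" "y \<in> carrier L" for x y
    by (rule eqI) (simp_all add: that closed comm add add' cl)
  moreover have "J (c \<odot>\<^bsub>L\<^esub> x) = c \<odot>\<^bsub>L\<^esub> J x" if "x \<in> carrier L" for c x
    by (rule eqI) (simp_all add: that closed comm smult smult' cl)
  ultimately have "J \<in> LinearCombinations.module_hom class_ring L L"
    unfolding LinearCombinations.module_hom_def using closed by simp
  moreover have "J (J x) = \<ominus>\<^bsub>L\<^esub> x" if "x \<in> carrier L" for x
    by (rule eqI) (simp_all add: that closed comm minus sq cl)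
  moreover have "J (bracket L x y) \<ominus>\<^bsub>L\<^esub> bracket L (J x) y \<ominus>\<^bsub>L\<^esub> bracket L x (J y)
        \<ominus>\<^bsub>L\<^esub> J (bracket L (J x) (J y)) = \<zero>\<^bsub>L\<^esub>" if "x \<in> carrier L" "y \<in> carrier L" for x y
    using nij[OF cl[OF that(1)] cl[OF that(2)]]
    by (intro eqI)
      (simp_all add: a_minus_def that closed comm add minus br zero L.bracket_closed)
  ultimately show ?thesis
    using L.real_lie_algebra_axioms by (simp add: complex_structure_def)
qed

section \<open>A subalgebra of the complexified Poincare algebra\<close>

definition minkowski_sign :: "nat \<Rightarrow> nat \<Rightarrow> real" where
  "minkowski_sign n i = (if i < n then 1 else - 1)"

text \<open>The equations that cut \<open>q\<close> out of the complexified algebra, with 0-based indices, so that the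
  space-like pairs are \<open>(a, Suc a)\<close> with \<open>a\<close> even and the time-like index is \<open>4 * k + 2\<close>. For skew
  \<open>M\<close> the first clause says that \<open>M\<close> stabilizes the isotropic flag; the second and third come from
  the generators \<open>h\<^sub>2\<^sub>i\<^sub>-\<^sub>1 - \<i> h\<^sub>2\<^sub>i\<close> and \<open>h\<^sub>2\<^sub>k\<^sub>+\<^sub>1 - \<i> e\<close>; the last says that the space-like part of \<open>w\<close>
  is a combination of the vectors \<open>z\<^sub>j\<close>.\<close>

definition holomorphic_relations ::
    "nat \<Rightarrow> (nat \<Rightarrow> nat \<Rightarrow> complex) \<Rightarrow> (nat \<Rightarrow> complex) \<Rightarrow> bool" where
  "holomorphic_relations k M w \<longleftrightarrow>
    (\<forall>a b. even a \<and> Suc a < b \<and> b \<le> 4 * k + 2 \<longrightarrow> M (Suc a) b = - \<i> * M a b) \<and>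
    (\<forall>r<k. M (4 * r + 2) (4 * r + 3) = - \<i> * M (4 * r) (4 * r + 1)) \<and>
    w (4 * k + 2) = - \<i> * M (4 * k) (4 * k + 1) \<and>
    (\<forall>a<4 * k + 2. even a \<longrightarrow> w (Suc a) = - \<i> * w a)"

definition minkowski_skew :: "nat \<Rightarrow> (nat \<Rightarrow> nat \<Rightarrow> complex) \<Rightarrow> bool" where
  "minkowski_skew n M \<longleftrightarrow> (\<forall>a\<le>n. \<forall>b\<le>n.
    M b a = - of_real (minkowski_sign n a * minkowski_sign n b) * M a b)"

lemma sum_pairs_zero:
  fixes f :: "nat \<Rightarrow> 'a::ab_group_add"
  assumes "\<And>j. j < m \<Longrightarrow> f (Suc (2 * j)) = - f (2 * j)"
  shows "(\<Sum>c<2 * m. f c) = 0"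
  using assms by (induction m) auto

lemma minkowski_skewD:
  "\<lbrakk>minkowski_skew n M; a \<le> n; b \<le> n\<rbrakk> \<Longrightarrow>
    M b a = - of_real (minkowski_sign n a * minkowski_sign n b) * M a b"
  unfolding minkowski_skew_def by blast

lemma skew_diag: "M a a = 0" if "minkowski_skew n M" "a \<le> n"
proof -
  have "M a a = - M a a"
    using minkowski_skewD[OF that that(2)] by (simp add: minkowski_sign_def split: if_splits)
  then show ?thesis by simp
qed

lemma skew_space: "M b a = - M a b" if "minkowski_skew n M" "a < n" "b < n"
  using minkowski_skewD[OF that(1), of a b] that(2,3) by (simp add: minkowski_sign_def)

lemma skew_time: "M n a = M a n" if "minkowski_skew n M" "a < n"
  using minkowski_skewD[OF that(1), of a n] that(2) by (simp add: minkowski_sign_def)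

text \<open>Skewness turns the row relation for the pair of \<open>2 * j\<close> into a column relation in all later
  rows.\<close>

lemma lower_pair_columns:
  assumes rel: "holomorphic_relations k M w" and skew: "minkowski_skew (4 * k + 2) M"
    and "Suc (2 * j) < a" "a < 4 * k + 2"
  shows "M a (Suc (2 * j)) = - \<i> * M a (2 * j)"
proof -
  have "M (Suc (2 * j)) a = - \<i> * M (2 * j) a"
    using rel assms(3,4) by (auto simp: holomorphic_relations_def)
  then show ?thesis
    using assms skew_space[OF skew, of "2 * j" a] skew_space[OF skew, of "Suc (2 * j)" a] by simp
qed

lemma split_at_pair:
  fixes f :: "nat \<Rightarrow> 'a::comm_monoid_add"
  assumes "Suc (2 * j) < n"
  shows "(\<Sum>c<n. f c) = (\<Sum>c<2 * j. f c) + f (2 * j) + f (Suc (2 * j)) + (\<Sum>c = 2 * j + 2..<n. f c)"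
proof -
  have "(\<Sum>c<n. f c) = (\<Sum>c<2 * j + 2. f c) + (\<Sum>c = 2 * j + 2..<n. f c)"
    using assms sum.atLeastLessThan_concat[of 0 "2 * j + 2" n f] by (simp add: lessThan_atLeast0)
  then show ?thesis by simp
qed

text \<open>The hypothesis on \<open>g\<close> says that \<open>g\<close> is orthogonal to \<open>z\<^sub>i\<close> for all pairs \<open>i\<close> up to the \<open>j\<close>-th,
  so this is the statement that \<open>M\<close> preserves the orthogonal complement of each member of the flag.
  It serves both for \<open>g\<close> a column of another matrix and for \<open>g\<close> a translation vector. Pairs before
  the \<open>j\<close>-th cancel in both sums, and for later indices the two rows are already proportional.\<close>

lemma relations_apply:
  assumes rel: "holomorphic_relations k M w" and skew: "minkowski_skew (4 * k + 2) M"
    and j: "2 * j < 4 * k + 2"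
    and g: "\<And>i. i \<le> j \<Longrightarrow> g (Suc (2 * i)) = - \<i> * g (2 * i)"
  shows "(\<Sum>c<4 * k + 3. M (Suc (2 * j)) c * g c) = - \<i> * (\<Sum>c<4 * k + 3. M (2 * j) c * g c)"
proof -
  have j': "Suc (2 * j) < 4 * k + 2" using j by presburger
  have low: "(\<Sum>c<2 * j. M a c * g c) = 0" if "a = 2 * j \<or> a = Suc (2 * j)" for a
    by (rule sum_pairs_zero)
      (use that j' g lower_pair_columns[OF rel skew, of _ a] in \<open>auto simp: algebra_simps\<close>)
  have high: "(\<Sum>c = 2 * j + 2..<4 * k + 3. M (Suc (2 * j)) c * g c)
      = - \<i> * (\<Sum>c = 2 * j + 2..<4 * k + 3. M (2 * j) c * g c)"
    unfolding sum_distrib_left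
    using rel by (intro sum.cong) (auto simp: holomorphic_relations_def)
  have s: "Suc (2 * j) < 4 * k + 3" using j' by simp
  show ?thesis
    unfolding split_at_pair[OF s] high
    using low j' g[of j] skew_diag[OF skew] skew_space[OF skew, of "2 * j" "Suc (2 * j)"]
    by (simp add: algebra_simps)
qed

text \<open>A commutator in a Borel subalgebra has zero eigenvalues: earlier pairs cancel, the pair itself
  contributes only the vanishing diagonal of a skew matrix, and in the later terms skewness gives a
  multiple of \<open>M (2 * j) c * M' (2 * j) c\<close>, which is symmetric in the two factors.\<close>

lemma relations_diagonal:
  assumes rel: "holomorphic_relations k M w" "holomorphic_relations k M' w'"
    and skew: "minkowski_skew (4 * k + 2) M" "minkowski_skew (4 * k + 2) M'"
    and j: "2 * j < 4 * k + 2"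
  shows "(\<Sum>c<4 * k + 3. M (2 * j) c * M' c (Suc (2 * j)))
    = (\<Sum>c<4 * k + 3. M' (2 * j) c * M c (Suc (2 * j)))"
proof -
  have j': "Suc (2 * j) < 4 * k + 2" using j by presburger
  have s: "Suc (2 * j) < 4 * k + 3" using j' by simp
  have low: "(\<Sum>c<2 * j. A (2 * j) c * B c (Suc (2 * j))) = 0"
    if A: "holomorphic_relations k A v" "minkowski_skew (4 * k + 2) A"
      and B: "holomorphic_relations k B z" for A B v z
  proof (rule sum_pairs_zero)
    fix i assume i: "i < j"
    then have "B (Suc (2 * i)) (Suc (2 * j)) = - \<i> * B (2 * i) (Suc (2 * j))"
      using B j' by (auto simp: holomorphic_relations_def)
    moreover have "A (2 * j) (Suc (2 * i)) = - \<i> * A (2 * j) (2 * i)"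
      by (rule lower_pair_columns[OF A]) (use i j in auto)
    ultimately show "A (2 * j) (Suc (2 * i)) * B (Suc (2 * i)) (Suc (2 * j))
        = - (A (2 * j) (2 * i) * B (2 * i) (Suc (2 * j)))"
      by (simp add: algebra_simps)
  qed
  have col: "B c (Suc (2 * j)) = \<i> * of_real (minkowski_sign (4 * k + 2) c) * B (2 * j) c"
    if "holomorphic_relations k B z" "minkowski_skew (4 * k + 2) B" "2 * j + 2 \<le> c" "c < 4 * k + 3"
    for B z c
  proof -
    have "B (Suc (2 * j)) c = - \<i> * B (2 * j) c"
      using that by (auto simp: holomorphic_relations_def)
    moreover have "B c (Suc (2 * j))
        = - of_real (minkowski_sign (4 * k + 2) c) * B (Suc (2 * j)) c"
      using minkowski_skewD[OF that(2), of "Suc (2 * j)" c] that(4) j' by (simp add: minkowski_sign_def)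
    ultimately show ?thesis by simp
  qed
  have high: "(\<Sum>c = 2 * j + 2..<4 * k + 3. M (2 * j) c * M' c (Suc (2 * j)))
      = (\<Sum>c = 2 * j + 2..<4 * k + 3. M' (2 * j) c * M c (Suc (2 * j)))"
    using col[OF rel(1) skew(1)] col[OF rel(2) skew(2)] by (intro sum.cong) auto
  show ?thesis
    unfolding split_at_pair[OF s] high
    using low[OF rel(1) skew(1) rel(2)] low[OF rel(2) skew(2) rel(1)] j'
      skew_diag[OF skew(1)] skew_diag[OF skew(2)] by simp
qed

text \<open>Since \<open>M\<close> is skew, it acts by zero on the line that \<open>e\<close> spans in the quotient of the
  orthogonal complement of \<open>F\<close> by \<open>F\<close>.\<close>

lemma relations_time_component:
  assumes rel: "holomorphic_relations k M w" "holomorphic_relations k M' w'"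
    and skew: "minkowski_skew (4 * k + 2) M"
  shows "(\<Sum>c<4 * k + 3. M (4 * k + 2) c * w' c) = 0"
proof -
  have "(\<Sum>c<2 * (2 * k + 1). M (4 * k + 2) c * w' c) = 0"
  proof (rule sum_pairs_zero)
    fix j assume j: "j < 2 * k + 1"
    then have "M (4 * k + 2) (Suc (2 * j)) = - \<i> * M (4 * k + 2) (2 * j)"
      using rel(1) skew_time[OF skew, of "2 * j"] skew_time[OF skew, of "Suc (2 * j)"]
      by (auto simp: holomorphic_relations_def)
    moreover have "w' (Suc (2 * j)) = - \<i> * w' (2 * j)"
      using rel(2) j by (auto simp: holomorphic_relations_def)
    ultimately show "M (4 * k + 2) (Suc (2 * j)) * w' (Suc (2 * j))
        = - (M (4 * k + 2) (2 * j) * w' (2 * j))"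
      by (simp add: algebra_simps)
  qed
  then show ?thesis
    using skew_diag[OF skew, of "4 * k + 2"] by (simp add: numeral_3_eq_3)
qed

lemma relations_bracket:
  assumes rel: "holomorphic_relations k M w" "holomorphic_relations k M' w'"
    and skew: "minkowski_skew (4 * k + 2) M" "minkowski_skew (4 * k + 2) M'"
  shows "holomorphic_relations k
    (\<lambda>a b. (\<Sum>c<4 * k + 3. M a c * M' c b) - (\<Sum>c<4 * k + 3. M' a c * M c b))
    (\<lambda>a. (\<Sum>c<4 * k + 3. M a c * w' c) - (\<Sum>c<4 * k + 3. M' a c * w c))"
proof -
  have mat: "(\<Sum>c<4 * k + 3. A (Suc a) c * B c b) = - \<i> * (\<Sum>c<4 * k + 3. A a c * B c b)"
    if A: "holomorphic_relations k A v" "minkowski_skew (4 * k + 2) A"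
      and B: "holomorphic_relations k B z" and ab: "even a" "Suc a < b" "b \<le> 4 * k + 2"
    for A B v z a b
  proof -
    obtain j where a: "a = 2 * j" using ab by (auto elim: evenE)
    have "B (Suc (2 * i)) b = - \<i> * B (2 * i) b" if "i \<le> j" for i
      using B ab that unfolding holomorphic_relations_def a by auto
    then show ?thesis
      unfolding a using ab by (intro relations_apply[OF A]) (auto simp: a)
  qed
  have vec: "(\<Sum>c<4 * k + 3. A (Suc a) c * z c) = - \<i> * (\<Sum>c<4 * k + 3. A a c * z c)"
    if A: "holomorphic_relations k A v" "minkowski_skew (4 * k + 2) A"
      and B: "holomorphic_relations k B z" and a: "even a" "a < 4 * k + 2"
    for A B v z a
  proof -
    obtain j where j: "a = 2 * j" using a by (auto elim: evenE)
    have "z (Suc (2 * i)) = - \<i> * z (2 * i)" if "i \<le> j" for i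
      using B a that unfolding holomorphic_relations_def j by auto
    then show ?thesis
      unfolding j using a by (intro relations_apply[OF A]) (auto simp: j)
  qed
  have diag: "(\<Sum>c<4 * k + 3. M (2 * j) c * M' c (Suc (2 * j)))
      - (\<Sum>c<4 * k + 3. M' (2 * j) c * M c (Suc (2 * j))) = 0" if "2 * j < 4 * k + 2" for j
    using relations_diagonal[OF rel skew that] by simp
  have diag1: "(\<Sum>c<4 * k + 3. M (4 * r) c * M' c (4 * r + 1))
      - (\<Sum>c<4 * k + 3. M' (4 * r) c * M c (4 * r + 1)) = 0" if "r \<le> k" for r
    using diag[of "2 * r"] that by simp
  have diag2: "(\<Sum>c<4 * k + 3. M (4 * r + 2) c * M' c (4 * r + 3))
      - (\<Sum>c<4 * k + 3. M' (4 * r + 2) c * M c (4 * r + 3)) = 0" if "r < k" for r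
    using diag[of "2 * r + 1"] that by (simp add: numeral_3_eq_3)
  note time = relations_time_component[OF rel skew(1)]
    relations_time_component[OF rel(2,1) skew(2)]
  show ?thesis
    unfolding holomorphic_relations_def
  proof (intro conjI allI impI)
    fix a b :: nat assume "even a \<and> Suc a < b \<and> b \<le> 4 * k + 2"
    then show "(\<Sum>c<4 * k + 3. M (Suc a) c * M' c b) - (\<Sum>c<4 * k + 3. M' (Suc a) c * M c b)
        = - \<i> * ((\<Sum>c<4 * k + 3. M a c * M' c b) - (\<Sum>c<4 * k + 3. M' a c * M c b))"
      using mat[OF rel(1) skew(1) rel(2), of a b] mat[OF rel(2) skew(2) rel(1), of a b]
      by (simp add: algebra_simps)
  next
    fix a :: nat assume "a < 4 * k + 2" "even a"
    then show "(\<Sum>c<4 * k + 3. M (Suc a) c * w' c) - (\<Sum>c<4 * k + 3. M' (Suc a) c * w c)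
        = - \<i> * ((\<Sum>c<4 * k + 3. M a c * w' c) - (\<Sum>c<4 * k + 3. M' a c * w c))"
      using vec[OF rel(1) skew(1) rel(2), of a] vec[OF rel(2) skew(2) rel(1), of a]
      by (simp add: algebra_simps)
  qed (simp_all only: diag1 diag2 time order_refl order_less_imp_le mult_zero_right diff_self)
qed

section \<open>The complex structure on the Poincare algebra\<close>

text \<open>The entries of \<open>x - \<i> y\<close> and of \<open>u - \<i> v\<close>.\<close>

definition complexify_mat :: "real mat \<Rightarrow> real mat \<Rightarrow> nat \<Rightarrow> nat \<Rightarrow> complex" where
  "complexify_mat x y a b = Complex (x $$ (a, b)) (- y $$ (a, b))"

definition complexify_vec :: "real vec \<Rightarrow> real vec \<Rightarrow> nat \<Rightarrow> complex" where
  "complexify_vec u v a = Complex (u $ a) (- v $ a)"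

definition J_graph :: "nat \<Rightarrow> real mat \<times> real vec \<Rightarrow> real mat \<times> real vec \<Rightarrow> bool" where
  "J_graph k = (\<lambda>(x, u) (y, v). holomorphic_relations k (complexify_mat x y) (complexify_vec u v))"

text \<open>The formula for \<open>J\<^sup>0\<close> above the diagonal is used unchanged in the additional last column, where it
  reads \<open>- x $$ (Suc a, b)\<close> or \<open>x $$ (a - 1, b)\<close>: the boosts are rotated within their pairs, as the
  generators \<open>z\<^sub>j \<and> e\<close> require. The time-like component of the vector replaces the central
  coordinate. Below the diagonal the entries are forced by skewness for the Minkowski form; as the
  column index is then space-like, only the sign of the row index appears.\<close>

definition poincare_J :: "nat \<Rightarrow> real mat \<times> real vec \<Rightarrow> real mat \<times> real vec" where
  "poincare_J k = (\<lambda>(x, u).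
    (mat (4 * k + 3) (4 * k + 3) (\<lambda>(a, b).
       if a < b then J0_upper k x (u $ (4 * k + 2)) a b
       else if b < a then - minkowski_sign (4 * k + 2) a * J0_upper k x (u $ (4 * k + 2)) b a
       else 0),
     vec (4 * k + 3) (\<lambda>a. if a = 4 * k + 2 then x $$ (4 * k, 4 * k + 1)
       else if even a then - u $ Suc a else u $ (a - 1))))"

lemma Complex_rotate:
  "Complex p (- q) = - \<i> * Complex p' (- q') \<longleftrightarrow> p = - q' \<and> q = p'"
  by (auto simp: complex_eq_iff)

lemma so_minkowski_iff:
  "x \<in> so_form (Suc n) (mat_diag (Suc n) (\<lambda>i. if i < n then 1 else - 1)) \<longleftrightarrow>
    x \<in> carrier_mat (Suc n) (Suc n) \<and>
    (\<forall>a\<le>n. \<forall>b\<le>n. x $$ (b, a) = - (minkowski_sign n a * minkowski_sign n b) * x $$ (a, b))"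
proof (cases "x \<in> carrier_mat (Suc n) (Suc n)")
  case True
  then have t: "transpose_mat x \<in> carrier_mat (Suc n) (Suc n)" by simp
  have "(transpose_mat x * mat_diag (Suc n) (minkowski_sign n)
      + mat_diag (Suc n) (minkowski_sign n) * x = 0\<^sub>m (Suc n) (Suc n)) \<longleftrightarrow>
    (\<forall>a\<le>n. \<forall>b\<le>n. minkowski_sign n b * x $$ (b, a) + minkowski_sign n a * x $$ (a, b) = 0)"
    unfolding mat_diag_mult_left[OF True] mat_diag_mult_right[OF t]
    using True by (auto simp: mat_eq_iff less_Suc_eq_le mult.commute)
  also have "\<dots> \<longleftrightarrow>
    (\<forall>a\<le>n. \<forall>b\<le>n. x $$ (b, a) = - (minkowski_sign n a * minkowski_sign n b) * x $$ (a, b))"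
    by (intro all_cong) (auto simp: minkowski_sign_def)
  finally show ?thesis
    using True by (simp add: so_form_def minkowski_sign_def[abs_def])
qed (auto simp: so_form_def)

text \<open>Each relation between complex numbers splits into two real equations by \<open>Complex_rotate\<close>, and
  together these determine \<open>(y, v)\<close> from \<open>(x, u)\<close> entry by entry.\<close>

lemma J_graph_entries:
  "J_graph k (x, u) (y, v) \<longleftrightarrow>
    (\<forall>a b. a < b \<and> b \<le> 4 * k + 2 \<longrightarrow> y $$ (a, b) = J0_upper k x (u $ (4 * k + 2)) a b) \<and>
    (\<forall>a\<le>4 * k + 2. v $ a = (if a = 4 * k + 2 then x $$ (4 * k, 4 * k + 1)
       else if even a then - u $ Suc a else u $ (a - 1)))"
proof (intro iffI conjI allI impI)
  assume J: "J_graph k (x, u) (y, v)"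
  let ?n = "4 * k + 2"
  note rel = J[unfolded J_graph_def holomorphic_relations_def split complexify_mat_def
      complexify_vec_def Complex_rotate]
  have upper: "x $$ (Suc a, b) = - y $$ (a, b)" "y $$ (Suc a, b) = x $$ (a, b)"
    if "even a" "Suc a < b" "b \<le> ?n" for a b
    using rel that by blast+
  have cartan: "x $$ (4 * r + 2, 4 * r + 3) = - y $$ (4 * r, 4 * r + 1)"
    "y $$ (4 * r + 2, 4 * r + 3) = x $$ (4 * r, 4 * r + 1)" if "r < k" for r
    using rel that by blast+
  have centre: "u $ ?n = - y $$ (4 * k, 4 * k + 1)" "v $ ?n = x $$ (4 * k, 4 * k + 1)"
    using rel by blast+
  have vector: "u $ Suc a = - v $ a" "v $ Suc a = u $ a" if "even a" "a < ?n" for a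
    using rel that by blast+
  show "y $$ (a, b) = J0_upper k x (u $ ?n) a b" if "a < b \<and> b \<le> ?n" for a b
  proof -
    consider (last) "a = 4 * k" "b = Suc a"
      | (h1) "even a" "b = Suc a" "a \<noteq> 4 * k" "even (a div 2)"
      | (h2) "even a" "b = Suc a" "a \<noteq> 4 * k" "odd (a div 2)"
      | (ev) "even a" "b \<noteq> Suc a" | (od) "odd a"
      by blast
    then show ?thesis
    proof cases
      case last
      then show ?thesis using centre by (simp add: J0_upper_def)
    next
      case h1
      then have "a = 4 * (a div 4)" by presburger
      then obtain r where r: "a = 4 * r" by blast
      then have "r < k" using h1 that by auto
      then show ?thesis using cartan h1 r by (simp add: J0_upper_def)
    next
      case h2
      then have "a = 4 * (a div 4) + 2" by presburger
      then obtain r where r: "a = 4 * r + 2" by blast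
      then have "r < k" using h2 that by auto
      then show ?thesis using cartan h2 r by (simp add: J0_upper_def numeral_3_eq_3)
    next
      case ev
      then show ?thesis using upper[of a b] that by (simp add: J0_upper_def)
    next
      case od
      then obtain r where r: "a = Suc (2 * r)" by (metis oddE Suc_eq_plus1)
      then show ?thesis using upper[of "2 * r" b] that by (simp add: J0_upper_def)
    qed
  qed
  show "v $ a = (if a = ?n then x $$ (4 * k, 4 * k + 1) else if even a then - u $ Suc a else u $ (a - 1))"
    if a: "a \<le> ?n" for a
  proof (cases "even a")
    case True
    then show ?thesis using centre vector[of a] a by auto
  next
    case False
    then obtain r where r: "a = Suc (2 * r)" by (metis oddE Suc_eq_plus1)
    then have "2 * r < ?n" "a \<noteq> ?n" using a by presburger+
    then show ?thesis using vector[of "2 * r"] r by simp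
  qed
next
  let ?n = "4 * k + 2"
  assume entries: "(\<forall>a b. a < b \<and> b \<le> ?n \<longrightarrow> y $$ (a, b) = J0_upper k x (u $ ?n) a b) \<and>
    (\<forall>a\<le>?n. v $ a = (if a = ?n then x $$ (4 * k, 4 * k + 1)
       else if even a then - u $ Suc a else u $ (a - 1)))"
  note mat = entries[THEN conjunct1, rule_format, OF conjI]
  note vec = entries[THEN conjunct2, rule_format]
  show "J_graph k (x, u) (y, v)"
    unfolding J_graph_def holomorphic_relations_def split complexify_mat_def complexify_vec_def
      Complex_rotate
  proof (intro conjI allI impI)
    fix a b :: nat assume ab: "even a \<and> Suc a < b \<and> b \<le> ?n"
    show "x $$ (Suc a, b) = - y $$ (a, b)" "y $$ (Suc a, b) = x $$ (a, b)"
      using ab mat[of a b] mat[of "Suc a" b] by (auto simp: J0_upper_def)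
  next
    fix r assume r: "r < k"
    have "odd (Suc (2 * r))" "(4 * r + 2) div 2 = Suc (2 * r)" by presburger+
    then show "x $$ (4 * r + 2, 4 * r + 3) = - y $$ (4 * r, 4 * r + 1)"
      "y $$ (4 * r + 2, 4 * r + 3) = x $$ (4 * r, 4 * r + 1)"
      using r mat[of "4 * r" "4 * r + 1"] mat[of "4 * r + 2" "4 * r + 3"]
      by (auto simp: J0_upper_def numeral_3_eq_3)
  next
    show "u $ ?n = - y $$ (4 * k, 4 * k + 1)" "v $ ?n = x $$ (4 * k, 4 * k + 1)"
      using mat[of "4 * k" "4 * k + 1"] vec[of ?n] by (auto simp: J0_upper_def)
  next
    fix a assume a: "a < ?n" "even a"
    then have "Suc a < ?n" using even_bound_Suc by blast
    then show "u $ Suc a = - v $ a" "v $ Suc a = u $ a"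
      using a vec[of a] vec[of "Suc a"] by auto
  qed
qed

lemma poincare_simps:
  "carrier (poincare_lie n) = so_form (Suc n) (mat_diag (Suc n) (\<lambda>i. if i < n then 1 else - 1))
    \<times> carrier_vec (Suc n)"
  "zero (poincare_lie n) = (0\<^sub>m (Suc n) (Suc n), 0\<^sub>v (Suc n))"
  "add (poincare_lie n) = (\<lambda>(x, u) (y, v). (x + y, u + v))"
  "smult (poincare_lie n) = (\<lambda>c (x, u). (c \<cdot>\<^sub>m x, c \<cdot>\<^sub>v u))"
  "bracket (poincare_lie n) = (\<lambda>(x, u) (y, v). (x * y - y * x, x *\<^sub>v v - y *\<^sub>v u))"
  by (simp_all add: poincare_lie_def affine_lie_def)

lemma poincare_carrier_dims:
  assumes "(x, u) \<in> carrier (poincare_lie n)"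
  shows "x \<in> carrier_mat (Suc n) (Suc n)" "u \<in> carrier_vec (Suc n)"
  using assms so_form_carrier by (auto simp: poincare_simps)

lemma poincare_carrierI:
  assumes "x \<in> carrier_mat (Suc n) (Suc n)" "u \<in> carrier_vec (Suc n)"
    and "\<And>a b. a \<le> n \<Longrightarrow> b \<le> n \<Longrightarrow>
      x $$ (b, a) = - (minkowski_sign n a * minkowski_sign n b) * x $$ (a, b)"
  shows "(x, u) \<in> carrier (poincare_lie n)"
  unfolding poincare_simps mem_Times_iff fst_conv snd_conv so_minkowski_iff using assms by blast

lemma poincare_skew:
  assumes "(x, u) \<in> carrier (poincare_lie n)" "a \<le> n" "b \<le> n"
  shows "x $$ (b, a) = - (minkowski_sign n a * minkowski_sign n b) * x $$ (a, b)"
  using assms(1)[unfolded poincare_simps mem_Times_iff fst_conv so_minkowski_iff] assms(2,3) by blast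

lemma poincare_uminus:
  assumes "(x, u) \<in> carrier (poincare_lie n)"
  shows "\<ominus>\<^bsub>poincare_lie n\<^esub> (x, u) = (- x, - u)"
proof -
  interpret L: real_lie_algebra "poincare_lie n" by (rule poincare_lie_algebra)
  note dims = poincare_carrier_dims[OF assms]
  have neg: "(- x, - u) \<in> carrier (poincare_lie n)"
  proof (rule poincare_carrierI)
    fix a b assume "a \<le> n" "b \<le> n"
    then show "(- x) $$ (b, a) = - (minkowski_sign n a * minkowski_sign n b) * (- x) $$ (a, b)"
      using dims poincare_skew[OF assms, of a b] by simp
  qed (use dims in auto)
  have "(- x, - u) \<oplus>\<^bsub>poincare_lie n\<^esub> (x, u) = \<zero>\<^bsub>poincare_lie n\<^esub>"
    using dims by (auto simp: poincare_simps)
  then show ?thesis by (rule L.minus_equality[OF _ assms neg])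
qed

lemma poincare_J_closed:
  "poincare_J k X \<in> carrier (poincare_lie (4 * k + 2))"
proof -
  obtain x u where X: "X = (x, u)" by (metis surj_pair)
  show ?thesis
    unfolding X poincare_J_def split
    by (rule poincare_carrierI) (auto simp: minkowski_sign_def intro!: carrier_matI carrier_vecI)
qed

lemma J_graph_iff:
  assumes X: "X \<in> carrier (poincare_lie (4 * k + 2))" and Y: "Y \<in> carrier (poincare_lie (4 * k + 2))"
  shows "J_graph k X Y \<longleftrightarrow> Y = poincare_J k X"
proof -
  let ?n = "4 * k + 2"
  obtain x u y v where d: "X = (x, u)" "Y = (y, v)" by (metis surj_pair)
  have y: "y \<in> carrier_mat (Suc ?n) (Suc ?n)" "v \<in> carrier_vec (Suc ?n)"
    using Y poincare_carrier_dims unfolding d by blast+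
  have skew: "y $$ (b, a) = - (minkowski_sign ?n a * minkowski_sign ?n b) * y $$ (a, b)"
    if "a \<le> ?n" "b \<le> ?n" for a b
    by (rule poincare_skew[OF Y[unfolded d] that])
  show ?thesis
  proof
    assume "J_graph k X Y"
    then have mat: "\<And>a b. a < b \<Longrightarrow> b \<le> ?n \<Longrightarrow> y $$ (a, b) = J0_upper k x (u $ ?n) a b"
      and vec: "\<And>a. a \<le> ?n \<Longrightarrow> v $ a = (if a = ?n then x $$ (4 * k, 4 * k + 1)
        else if even a then - u $ Suc a else u $ (a - 1))"
      unfolding d J_graph_entries by blast+
    have "y = fst (poincare_J k X)"
    proof (rule eq_matI)
      fix a b assume "a < dim_row (fst (poincare_J k X))" "b < dim_col (fst (poincare_J k X))"
      then have l: "a \<le> ?n" "b \<le> ?n" by (auto simp: d poincare_J_def)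
      consider "a < b" | "a = b" | "b < a" by linarith
      then show "y $$ (a, b) = fst (poincare_J k X) $$ (a, b)"
      proof cases
        case 1
        then show ?thesis using l mat by (simp add: d poincare_J_def)
      next
        case 2
        then show ?thesis
          using l skew[of a a] by (auto simp: d poincare_J_def minkowski_sign_def split: if_splits)
      next
        case 3
        then show ?thesis
          using l skew[of b a] mat[of b a] by (auto simp: d poincare_J_def minkowski_sign_def)
      qed
    qed (use y in \<open>auto simp: d poincare_J_def\<close>)
    moreover have "v = snd (poincare_J k X)"
      by (rule eq_vecI) (use y vec in \<open>auto simp: d poincare_J_def\<close>)
    ultimately show "Y = poincare_J k X" by (simp add: d)
  next
    assume "Y = poincare_J k X"
    then show "J_graph k X Y"
      unfolding d J_graph_entries by (auto simp: poincare_J_def)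
  qed
qed

lemma holomorphic_relations_cong:
  assumes "\<And>a b. a \<le> 4 * k + 2 \<Longrightarrow> b \<le> 4 * k + 2 \<Longrightarrow> M a b = M' a b"
    and "\<And>a. a \<le> 4 * k + 2 \<Longrightarrow> w a = w' a"
    and "holomorphic_relations k M' w'"
  shows "holomorphic_relations k M w"
  unfolding holomorphic_relations_def
proof (intro conjI allI impI)
  note rel = assms(3)[unfolded holomorphic_relations_def]
  {
    fix a b assume "even a \<and> Suc a < b \<and> b \<le> 4 * k + 2"
    then have "Suc a \<le> 4 * k + 2" "a \<le> 4 * k + 2" "b \<le> 4 * k + 2" "M' (Suc a) b = - \<i> * M' a b"
      using rel by auto
    then show "M (Suc a) b = - \<i> * M a b" by (simp only: assms(1))
  next
    fix r assume "r < k"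
    then have "4 * r + 3 \<le> 4 * k + 2" "M' (4 * r + 2) (4 * r + 3) = - \<i> * M' (4 * r) (4 * r + 1)"
      using rel by auto
    then show "M (4 * r + 2) (4 * r + 3) = - \<i> * M (4 * r) (4 * r + 1)" by (simp add: assms(1))
  next
    show "w (4 * k + 2) = - \<i> * M (4 * k) (4 * k + 1)" using rel by (simp add: assms(1,2))
  next
    fix a assume a: "a < 4 * k + 2" "even a"
    then have "Suc a \<le> 4 * k + 2" "w' (Suc a) = - \<i> * w' a" using rel by auto
    with a show "w (Suc a) = - \<i> * w a" by (simp add: assms(2))
  }
qed

lemma holomorphic_relations_linear:
  assumes "holomorphic_relations k M w" "holomorphic_relations k M' w'"
  shows "holomorphic_relations k (\<lambda>a b. s * M a b + t * M' a b) (\<lambda>a. s * w a + t * w' a)"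
proof -
  have combine: "s * p' + t * q' = - \<i> * (s * p + t * q)"
    if "p' = - \<i> * p" "q' = - \<i> * q" for p p' q q'
    unfolding that by (simp add: algebra_simps)
  show ?thesis
    unfolding holomorphic_relations_def
    by (intro conjI allI impI combine) (use assms in \<open>auto simp: holomorphic_relations_def\<close>)
qed

lemma complexify_skew:
  assumes "(x, u) \<in> carrier (poincare_lie n)" "(y, v) \<in> carrier (poincare_lie n)"
  shows "minkowski_skew n (complexify_mat x y)"
proof -
  have "complexify_mat x y b a
      = - of_real (minkowski_sign n a * minkowski_sign n b) * complexify_mat x y a b"
    if "a \<le> n" "b \<le> n" for a b
    unfolding complexify_mat_def poincare_skew[OF assms(1) that] poincare_skew[OF assms(2) that]
    by (simp add: complex_eq_iff)
  then show ?thesis unfolding minkowski_skew_def by blast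
qed

lemma complexify_mult:
  assumes "x \<in> carrier_mat N N" "y \<in> carrier_mat N N" "x' \<in> carrier_mat N N" "y' \<in> carrier_mat N N"
    and "a < N" "b < N"
  shows "(\<Sum>c<N. complexify_mat x y a c * complexify_mat x' y' c b)
    = Complex ((x * x') $$ (a, b) - (y * y') $$ (a, b)) (- ((x * y') $$ (a, b) + (y * x') $$ (a, b)))"
  using assms
  by (simp add: complex_eq_iff complexify_mat_def scalar_prod_def lessThan_atLeast0
      sum.distrib sum_subtractf sum_negf)

lemma complexify_mult_vec:
  assumes "x \<in> carrier_mat N N" "y \<in> carrier_mat N N" "u \<in> carrier_vec N" "v \<in> carrier_vec N"
    and "a < N"
  shows "(\<Sum>c<N. complexify_mat x y a c * complexify_vec u v c)
    = Complex ((x *\<^sub>v u) $ a - (y *\<^sub>v v) $ a) (- ((x *\<^sub>v v) $ a + (y *\<^sub>v u) $ a))"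
  using assms
  by (simp add: complex_eq_iff complexify_mat_def complexify_vec_def scalar_prod_def
      lessThan_atLeast0 sum.distrib sum_subtractf sum_negf)

text \<open>Closure of \<open>q\<close> under complex linear combinations, phrased for the real and imaginary parts. Sums,
  real multiples and multiplication by \<open>\<i>\<close> are all instances.\<close>

lemma J_graph_linear:
  assumes "J_graph k (x, u) (y, v)" "J_graph k (x', u') (y', v')"
    and "\<And>a b. a \<le> 4 * k + 2 \<Longrightarrow> b \<le> 4 * k + 2 \<Longrightarrow>
      complexify_mat p q a b = s * complexify_mat x y a b + t * complexify_mat x' y' a b"
    and "\<And>a. a \<le> 4 * k + 2 \<Longrightarrow>
      complexify_vec f g a = s * complexify_vec u v a + t * complexify_vec u' v' a"
  shows "J_graph k (p, f) (q, g)"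
  unfolding J_graph_def split
  by (rule holomorphic_relations_cong[OF assms(3,4) holomorphic_relations_linear])
    (use assms(1,2) in \<open>simp_all only: J_graph_def split\<close>)

lemma J_graph_bracket:
  assumes c: "(x, u) \<in> carrier (poincare_lie (4 * k + 2))" "(y, v) \<in> carrier (poincare_lie (4 * k + 2))"
    and c': "(x', u') \<in> carrier (poincare_lie (4 * k + 2))" "(y', v') \<in> carrier (poincare_lie (4 * k + 2))"
    and G: "J_graph k (x, u) (y, v)" "J_graph k (x', u') (y', v')"
  shows "J_graph k
    (x * x' - x' * x + - (y * y' - y' * y), x *\<^sub>v u' - x' *\<^sub>v u + - (y *\<^sub>v v' - y' *\<^sub>v v))
    (x * y' - y' * x + (y * x' - x' * y), x *\<^sub>v v' - y' *\<^sub>v u + (y *\<^sub>v u' - x' *\<^sub>v v))"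
  unfolding J_graph_def split
proof (rule holomorphic_relations_cong[OF _ _ relations_bracket[OF G[unfolded J_graph_def split]
        complexify_skew[OF c] complexify_skew[OF c']]])
  let ?N = "4 * k + 3"
  have N: "Suc (4 * k + 2) = ?N" by simp
  note D = poincare_carrier_dims[OF c(1), unfolded N] poincare_carrier_dims[OF c(2), unfolded N]
    and D' = poincare_carrier_dims[OF c'(1), unfolded N] poincare_carrier_dims[OF c'(2), unfolded N]
  {
    fix a b assume "a \<le> 4 * k + 2" "b \<le> 4 * k + 2"
    then have ab: "a < ?N" "b < ?N" by auto
    show "complexify_mat (x * x' - x' * x + - (y * y' - y' * y))
        (x * y' - y' * x + (y * x' - x' * y)) a b
      = (\<Sum>c<?N. complexify_mat x y a c * complexify_mat x' y' c b)
        - (\<Sum>c<?N. complexify_mat x' y' a c * complexify_mat x y c b)"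
      unfolding complexify_mult[OF D(1,3) D'(1,3) ab] complexify_mult[OF D'(1,3) D(1,3) ab]
      using ab D D'
      by (simp add: complexify_mat_def complex_eq_iff del: index_mult_mat(1))
  next
    fix a assume "a \<le> 4 * k + 2"
    then have a: "a < ?N" by auto
    show "complexify_vec (x *\<^sub>v u' - x' *\<^sub>v u + - (y *\<^sub>v v' - y' *\<^sub>v v))
        (x *\<^sub>v v' - y' *\<^sub>v u + (y *\<^sub>v u' - x' *\<^sub>v v)) a
      = (\<Sum>c<?N. complexify_mat x y a c * complexify_vec u' v' c)
        - (\<Sum>c<?N. complexify_mat x' y' a c * complexify_vec u v c)"
      unfolding complexify_mult_vec[OF D(1,3) D'(2,4) a] complexify_mult_vec[OF D'(1,3) D(2,4) a]
      using a D D'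
      by (simp add: complexify_vec_def complex_eq_iff del: index_mult_mat_vec)
  }
qed

lemma poincare_complex_structure:
  "complex_structure (poincare_lie (4 * k + 2)) (poincare_J k)"
proof (rule complex_structure_of_graph[where G = "J_graph k"])
  let ?L = "poincare_lie (4 * k + 2)"
  interpret L: real_lie_algebra ?L by (rule poincare_lie_algebra)
  fix X Y assume c: "X \<in> carrier ?L" "Y \<in> carrier ?L" and G: "J_graph k X Y"
  obtain x u where X: "X = (x, u)" by (cases X)
  obtain y v where Y: "Y = (y, v)" by (cases Y)
  note dims = poincare_carrier_dims[OF c(1)[unfolded X]] poincare_carrier_dims[OF c(2)[unfolded Y]]
  note G0 = G[unfolded X Y]
  show "J_graph k (s \<odot>\<^bsub>?L\<^esub> X) (s \<odot>\<^bsub>?L\<^esub> Y)" for s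
    unfolding X Y poincare_simps split
    by (rule J_graph_linear[OF G0 G0, of _ _ "of_real s" 0])
      (use dims in \<open>simp_all add: complexify_mat_def complexify_vec_def complex_eq_iff\<close>)
  show "J_graph k Y (\<ominus>\<^bsub>?L\<^esub> X)"
    unfolding X Y poincare_uminus[OF c(1)[unfolded X]]
    by (rule J_graph_linear[OF G0 G0, of _ _ \<i> 0])
      (use dims in \<open>simp_all add: complexify_mat_def complexify_vec_def complex_eq_iff\<close>)
  fix X' Y' assume c': "X' \<in> carrier ?L" "Y' \<in> carrier ?L" and G': "J_graph k X' Y'"
  obtain x' u' where X': "X' = (x', u')" by (cases X')
  obtain y' v' where Y': "Y' = (y', v')" by (cases Y')
  note dims' = poincare_carrier_dims[OF c'(1)[unfolded X']] poincare_carrier_dims[OF c'(2)[unfolded Y']]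
  note G1 = G'[unfolded X' Y']
  show "J_graph k (X \<oplus>\<^bsub>?L\<^esub> X') (Y \<oplus>\<^bsub>?L\<^esub> Y')"
    unfolding X Y X' Y' poincare_simps split
    by (rule J_graph_linear[OF G0 G1, of _ _ 1 1])
      (use dims dims' in \<open>simp_all add: complexify_mat_def complexify_vec_def complex_eq_iff\<close>)
  have br: "bracket ?L Y Y' = (y * y' - y' * y, y *\<^sub>v v' - y' *\<^sub>v v)"
    by (simp add: Y Y' poincare_simps)
  then have "(y * y' - y' * y, y *\<^sub>v v' - y' *\<^sub>v v) \<in> carrier ?L"
    using L.bracket_closed[OF c(2) c'(2)] by simp
  from poincare_uminus[OF this]
  have minus: "\<ominus>\<^bsub>?L\<^esub> bracket ?L Y Y' = (- (y * y' - y' * y), - (y *\<^sub>v v' - y' *\<^sub>v v))"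
    by (simp only: br)
  show "J_graph k (bracket ?L X X' \<ominus>\<^bsub>?L\<^esub> bracket ?L Y Y') (bracket ?L X Y' \<oplus>\<^bsub>?L\<^esub> bracket ?L Y X')"
    unfolding a_minus_def minus unfolding X Y X' Y' poincare_simps split
    by (rule J_graph_bracket) (use c c' G0 G1 in \<open>simp_all only: X Y X' Y'\<close>)
qed (simp_all only: poincare_lie_algebra poincare_J_closed J_graph_iff)

section \<open>The block embedding\<close>

definition pad_mat :: "nat \<Rightarrow> real mat \<Rightarrow> real mat" where
  "pad_mat n x = four_block_mat x (0\<^sub>m n 1) (0\<^sub>m 1 n) (0\<^sub>m 1 1)"

lemma block_embedding_pad: "block_embedding n = (\<lambda>((x, u), t). (pad_mat n x, u @\<^sub>v vec 1 (\<lambda>_. t)))"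
  unfolding block_embedding_def pad_mat_def ..

lemma pad_mat_dim [simp]:
  "dim_row (pad_mat n x) = Suc (dim_row x)" "dim_col (pad_mat n x) = Suc (dim_col x)"
  by (simp_all add: pad_mat_def)

lemma pad_mat_carrier: "x \<in> carrier_mat n n \<Longrightarrow> pad_mat n x \<in> carrier_mat (Suc n) (Suc n)"
  by (rule carrier_matI) auto

lemma pad_mat_entry:
  assumes "x \<in> carrier_mat n n" "a \<le> n" "b \<le> n"
  shows "pad_mat n x $$ (a, b) = (if a < n \<and> b < n then x $$ (a, b) else 0)"
  using assms by (auto simp: pad_mat_def four_block_mat_def Let_def)

lemma pad_mat_eqI:
  assumes "x \<in> carrier_mat n n" "z \<in> carrier_mat (Suc n) (Suc n)"
    and "\<And>a b. a \<le> n \<Longrightarrow> b \<le> n \<Longrightarrow> z $$ (a, b) = (if a < n \<and> b < n then x $$ (a, b) else 0)"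
  shows "pad_mat n x = z"
  by (rule eq_matI)
    (use assms pad_mat_entry[OF assms(1)] pad_mat_carrier[OF assms(1)] in \<open>auto simp: less_Suc_eq_le\<close>)

lemma pad_mat_minus:
  assumes "x \<in> carrier_mat n n" "y \<in> carrier_mat n n"
  shows "pad_mat n (x - y) = pad_mat n x - pad_mat n y"
  by (rule pad_mat_eqI)
    (use assms pad_mat_entry[OF assms(1)] pad_mat_entry[OF assms(2)] in \<open>auto intro!: minus_carrier_mat\<close>)

lemma pad_mat_mult:
  assumes "x \<in> carrier_mat n n" "y \<in> carrier_mat n n"
  shows "pad_mat n x * pad_mat n y
    = pad_mat n (x * y)"
  using assms unfolding pad_mat_def
  by (subst mult_four_block_mat[of _ n n _ 1 _ 1 _ _ n _ 1]) auto

lemma pad_mat_mult_vec: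
  assumes "x \<in> carrier_mat n n" "u \<in> carrier_vec n"
  shows "pad_mat n x *\<^sub>v (u @\<^sub>v vec 1 (\<lambda>_. t))
    = (x *\<^sub>v u) @\<^sub>v vec 1 (\<lambda>_. 0)"
  using assms unfolding pad_mat_def
  by (subst four_block_mat_mult_vec[of _ n n _ 1 _ 1]) (auto simp: vec_eq_iff scalar_prod_def)

lemma block_embedding_closed:
  assumes "X \<in> carrier (euclidean_line_lie n)"
  shows "block_embedding n X \<in> carrier (poincare_lie n)"
proof -
  obtain x u t where X: "X = ((x, u), t)" by (metis surj_pair)
  have x: "x \<in> so_form n (1\<^sub>m n)" "u \<in> carrier_vec n"
    using assms by (auto simp: X euclidean_line_simps)
  note xc = so_form_carrier[OF x(1)]
  have "pad_mat n x $$ (b, a)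
      = - (minkowski_sign n a * minkowski_sign n b)
        * pad_mat n x $$ (a, b)" if "a \<le> n" "b \<le> n" for a b
    using that skew_entries[OF x(1), of a b]
    by (simp add: pad_mat_entry[OF xc] minkowski_sign_def)
  moreover have "pad_mat n x \<in> carrier_mat (Suc n) (Suc n)"
    "u @\<^sub>v vec 1 (\<lambda>_. t) \<in> carrier_vec (Suc n)"
    using pad_mat_carrier[OF xc] x(2) by (auto intro!: carrier_vecI)
  ultimately show ?thesis
    unfolding X block_embedding_pad split by (intro poincare_carrierI)
qed

lemma block_embedding_lie: "lie_embedding (euclidean_line_lie n) (poincare_lie n) (block_embedding n)"
proof -
  let ?L = "euclidean_line_lie n" and ?M = "poincare_lie n" and ?\<phi> = "block_embedding n"
  have dims: "x \<in> carrier_mat n n" "u \<in> carrier_vec n" if "((x, u), t) \<in> carrier ?L" for x u t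
    using that so_form_carrier by (auto simp: euclidean_line_simps)
  have add: "?\<phi> (X \<oplus>\<^bsub>?L\<^esub> Y) = ?\<phi> X \<oplus>\<^bsub>?M\<^esub> ?\<phi> Y" if XY: "X \<in> carrier ?L" "Y \<in> carrier ?L" for X Y
  proof -
    obtain x u s y v t where d: "X = ((x, u), s)" "Y = ((y, v), t)" by (metis surj_pair)
    note c = dims[OF XY(1)[unfolded d]] dims[OF XY(2)[unfolded d]]
    have "pad_mat n (x + y) = pad_mat n x + pad_mat n y"
      by (rule pad_mat_eqI) (use c pad_mat_carrier pad_mat_entry[OF c(1)] pad_mat_entry[OF c(3)] in auto)
    moreover have "(u + v) @\<^sub>v vec 1 (\<lambda>_. s + t) = (u @\<^sub>v vec 1 (\<lambda>_. s)) + (v @\<^sub>v vec 1 (\<lambda>_. t))"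
      using c by (auto simp: vec_eq_iff)
    ultimately show ?thesis
      by (simp add: d euclidean_line_simps poincare_simps block_embedding_pad)
  qed
  have smult: "?\<phi> (r \<odot>\<^bsub>?L\<^esub> X) = r \<odot>\<^bsub>?M\<^esub> ?\<phi> X" if X: "X \<in> carrier ?L" for r X
  proof -
    obtain x u s where d: "X = ((x, u), s)" by (metis surj_pair)
    note c = dims[OF X[unfolded d]]
    have "pad_mat n (r \<cdot>\<^sub>m x) = r \<cdot>\<^sub>m pad_mat n x"
      by (rule pad_mat_eqI) (use c pad_mat_carrier pad_mat_entry[OF c(1)] in auto)
    moreover have "(r \<cdot>\<^sub>v u) @\<^sub>v vec 1 (\<lambda>_. r * s) = r \<cdot>\<^sub>v (u @\<^sub>v vec 1 (\<lambda>_. s))"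
      using c by (auto simp: vec_eq_iff)
    ultimately show ?thesis
      by (simp add: d euclidean_line_simps poincare_simps block_embedding_pad)
  qed
  have bracket: "?\<phi> (bracket ?L X Y) = bracket ?M (?\<phi> X) (?\<phi> Y)"
    if XY: "X \<in> carrier ?L" "Y \<in> carrier ?L" for X Y
  proof -
    obtain x u s y v t where d: "X = ((x, u), s)" "Y = ((y, v), t)" by (metis surj_pair)
    note c = dims[OF XY(1)[unfolded d]] dims[OF XY(2)[unfolded d]]
    have p: "x * y \<in> carrier_mat n n" "y * x \<in> carrier_mat n n" using c by auto
    have "pad_mat n (x * y - y * x) = pad_mat n (x * y) - pad_mat n (y * x)"
      by (rule pad_mat_minus[OF p(1,2)])
    moreover have "(x *\<^sub>v v - y *\<^sub>v u) @\<^sub>v vec 1 (\<lambda>_. 0)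
        = ((x *\<^sub>v v) @\<^sub>v vec 1 (\<lambda>_. 0)) - ((y *\<^sub>v u) @\<^sub>v vec 1 (\<lambda>_. 0 :: real))"
      using c by (auto simp: vec_eq_iff)
    ultimately show ?thesis
      using c pad_mat_mult[OF c(1,3)] pad_mat_mult[OF c(3,1)]
        pad_mat_mult_vec[OF c(1,4), of t] pad_mat_mult_vec[OF c(3,2), of s]
      by (simp add: d euclidean_line_lie_def lie_direct_sum_def euclidean_lie_def affine_lie_def
          line_lie_def poincare_simps block_embedding_pad)
  qed
  have inj: "inj_on ?\<phi> (carrier ?L)"
  proof (rule inj_onI)
    fix X Y assume XY: "X \<in> carrier ?L" "Y \<in> carrier ?L" and eq: "?\<phi> X = ?\<phi> Y"
    obtain x u s y v t where d: "X = ((x, u), s)" "Y = ((y, v), t)" by (metis surj_pair)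
    note c = dims[OF XY(1)[unfolded d]] dims[OF XY(2)[unfolded d]]
    have B: "pad_mat n x = pad_mat n y" and V: "u @\<^sub>v vec 1 (\<lambda>_. s) = v @\<^sub>v vec 1 (\<lambda>_. t)"
      using eq by (auto simp: d block_embedding_pad)
    have "x = y"
    proof (rule eq_matI)
      fix a b assume "a < dim_row y" "b < dim_col y"
      then show "x $$ (a, b) = y $$ (a, b)"
        using c pad_mat_entry[OF c(1), of a b] pad_mat_entry[OF c(3), of a b] B by auto
    qed (use c in auto)
    moreover have "u = v" "vec 1 (\<lambda>_. s) = vec 1 (\<lambda>_. t)"
      using append_vec_eq[OF c(2,4)] V by blast+
    then have "u = v" "s = t" by (auto simp: vec_eq_iff)
    ultimately show "X = Y" by (simp add: d)
  qed
  have "?\<phi> \<in> LinearCombinations.module_hom class_ring ?L ?M"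
    unfolding LinearCombinations.module_hom_def using block_embedding_closed add smult by simp
  then show ?thesis
    unfolding lie_embedding_def
    using euclidean_line_lie_algebra poincare_lie_algebra inj bracket by blast
qed

text \<open>The formula reads only space-like entries: the coefficient at \<open>h\<^sub>2\<^sub>i\<^sub>-\<^sub>1\<close> is taken from the pair after
  it, which is again space-like because the last \<open>h\<close> is treated separately.\<close>

lemma J0_upper_cong:
  assumes "\<And>i j. i < 4 * k + 2 \<Longrightarrow> j < 4 * k + 2 \<Longrightarrow> x $$ (i, j) = x' $$ (i, j)"
    and "a < b" "b < 4 * k + 2"
  shows "J0_upper k x t a b = J0_upper k x' t a b"
  using assms(2,3) even_bound[of a k] by (auto simp: J0_upper_def assms(1))

text \<open>It suffices to compare entries above the diagonal. In the last column both sides vanish, as an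
  element of the image has no boost part; elsewhere they are given by the same formula.\<close>

lemma block_embedding_J:
  assumes X: "X \<in> carrier (euclidean_line_lie (4 * k + 2))"
  shows "block_embedding (4 * k + 2) (J0 k X) = poincare_J k (block_embedding (4 * k + 2) X)"
proof -
  let ?n = "4 * k + 2"
  obtain x u t where d: "X = ((x, u), t)" by (metis surj_pair)
  have c: "x \<in> carrier_mat ?n ?n" "u \<in> carrier_vec ?n"
    using X so_form_carrier by (auto simp: d euclidean_line_simps)
  have jc: "J0_mat k x t \<in> carrier_mat ?n ?n" by (simp add: J0_mat_def)
  have JX: "J0_coord k X \<in> carrier (euclidean_line_lie ?n)"
    using LinearCombinations.module_hom_closed[OF J0_coord_hom] X by blast
  note B = pad_mat_entry[OF c(1)]
  have t: "(u @\<^sub>v vec 1 (\<lambda>_. t)) $ ?n = t" using c by simp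
  have mat: "pad_mat ?n (J0_mat k x t) $$ (a, b) = J0_upper k (pad_mat ?n x) t a b" if ab: "a < b" "b \<le> ?n" for a b
  proof (cases "b = ?n")
    case True
    then have "even a \<Longrightarrow> b \<noteq> Suc a" by presburger
    moreover have "pad_mat ?n z $$ (i, ?n) = 0" if "z \<in> carrier_mat ?n ?n" "i \<le> ?n" for z i
      using pad_mat_entry[OF that order_refl] by simp
    ultimately show ?thesis
      unfolding True using ab c(1) jc by (simp only: J0_upper_def True) simp
  next
    case False
    have inner: "x $$ (i, j) = pad_mat ?n x $$ (i, j)" if "i < ?n" "j < ?n" for i j
      using B[of i j] that by simp
    from False have "pad_mat ?n (J0_mat k x t) $$ (a, b) = J0_upper k x t a b"
      using ab pad_mat_entry[OF jc, of a b] J0_mat_upper[of a b k x t] by simp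
    also have "\<dots> = J0_upper k (pad_mat ?n x) t a b"
      by (rule J0_upper_cong[OF inner]) (use ab False in simp_all)
    finally show ?thesis .
  qed
  have vec: "(J0_vec k u @\<^sub>v vec 1 (\<lambda>_. x $$ (4 * k, Suc (4 * k)))) $ a
      = (if a = ?n then pad_mat ?n x $$ (4 * k, 4 * k + 1)
        else if even a then - (u @\<^sub>v vec 1 (\<lambda>_. t)) $ Suc a else (u @\<^sub>v vec 1 (\<lambda>_. t)) $ (a - 1))"
    if "a \<le> ?n" for a
  proof (cases "a = ?n")
    case True
    then show ?thesis using B[of "4 * k" "4 * k + 1"] by (simp add: J0_vec_dim)
  next
    case False
    then show ?thesis
      using that c even_bound_Suc[of a k] by (auto simp: J0_vec_dim J0_vec_entry)
  qed
  have "J_graph k (block_embedding ?n X) (block_embedding ?n (J0_coord k X))"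
    unfolding d block_embedding_pad J0_coord_def split J_graph_entries t
    by (intro conjI allI impI mat vec) simp_all
  then show ?thesis
    using J_graph_iff block_embedding_closed X JX by (simp add: J0_eq_coord)
qed

theorem theorem3p7:
  fixes k :: nat
  shows "\<exists>J. complex_structure (poincare_lie (4 * k + 2)) J \<and>
    holomorphic_embedding (euclidean_line_lie (4 * k + 2)) (J0 k)
      (poincare_lie (4 * k + 2)) J (block_embedding (4 * k + 2))"
proof (intro exI conjI)
  have closed: "J0 k X \<in> carrier (euclidean_line_lie (4 * k + 2))"
    if "X \<in> carrier (euclidean_line_lie (4 * k + 2))" for X
    using LinearCombinations.module_hom_closed[OF is_J0D(1)[OF J0_is_J0]] that by blast
  show "complex_structure (poincare_lie (4 * k + 2)) (poincare_J k)"
    by (rule poincare_complex_structure)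
  have "complex_structure (euclidean_line_lie (4 * k + 2)) (J0 k)"
    by (rule complex_structure_pullback[OF block_embedding_lie poincare_complex_structure])
      (fact closed block_embedding_J)+
  then show "holomorphic_embedding (euclidean_line_lie (4 * k + 2)) (J0 k)
      (poincare_lie (4 * k + 2)) (poincare_J k) (block_embedding (4 * k + 2))"
    unfolding holomorphic_embedding_def
    by (intro conjI ballI poincare_complex_structure block_embedding_lie block_embedding_J)
qed

end
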